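(* Let $A$ be a local commutative principal ideal ring of length $k\in\{1,2,\dots\}\cup\{\infty\}$ with maximal ideal $\wp=(\pi)$, and let $B$ be the group of upper triangular matrices in $GL_3(A)$. The double coset space $B\backslash GL_3(A)/B$ is parameterised by \[ B\backslash GL_3(A)/B=(B_2\backslash M_2^{\bullet}/B_2)\ \sqcup\ (v(\wp)\times v(\wp))\ \sqcup\ (v(\wp)\times v(\wp))\ \sqcup\ v(\wp)\ \sqcup\ v(\wp)\ \sqcup\ \{\star\}, \] where \[ B_2\backslash M_2^{\bullet}/B_2=\coprod_{j=2}^{k-1}\left[\left(\coprod_{\substack{1\le i,l\le j-1\\ i+l\ne j}}A^{\times}_{\min\{\epsilon,k-j\}}\right)\sqcup\left(\coprod_{\substack{1\le i,l\le j-1\\ i+l=j}}\ \coprod_{\delta=0}^{k-j}A^{\times,\delta}_{\min\{\epsilon+\delta,k-j\}}\right)\right]\ \sqcup\ D, \] \[ D=\left\{\begin{pmatrix} i&0\\ j&l\end{pmatrix}\ \middle|\ [\,j=k,\ 1\le i,l\le k\,]\ \text{or}\ [\,i<j<k=l\,]\ \text{or}\ [\,l<j<k=i\,]\right\}, \] with $\epsilon=\epsilon(i,j,l)=\min\{j-i,\,j-l,\,i,\,l\}$ and $A_m^{\times,\delta}=\{a\in A_m^\times : v(a-1)=\delta\}$.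
   Context: The length $k$ of $A$ is the least positive integer with $\wp^k=0$, and $k=\infty$ if there is none. For nonzero $x\in A$, $v(x)$ is its valuation (the largest $r$ with $x\in\wp^r$), and $v(0)=k$; $v(\wp)$ is the set of values of $v$ on $\wp$, so $v(\wp)=\{1,\dots,k\}$ (including $\infty$ when $k=\infty$). $A_m=A/\wp^m$, with valuation defined in the same way and $v(0)=m$. When $k=\infty$, $A$ is a domain, reduction modulo $\pi^{k-j}$ is to be ignored (so $A_{k-j}$ means $A$), $\pi^k$ means $0$, and $j$ runs over all integers $\ge 2$. $M_2^\bullet$ is the set of $2\times2$ matrices over $A$ for which only the top right entry is a unit. $B_2$ is the group of upper triangular matrices in $GL_2(A)$, and $B_2\backslash M_2^\bullet/B_2$ is the set of orbits $B_2\alpha B_2$, $\alpha\in M_2^\bullet$. Meaning of the parametrisation. Reduction modulo $\wp$ and the Bruhat decomposition over the residue field $A/\wp$ give a map $B\backslash GL_3(A)/B\to S_3$. The six pieces of the first disjoint union are, in order, the fibres of this map over the permutation matrices \[ \begin{pmatrix}1&0&0\\0&1&0\\0&0&1\end{pmatrix},\ \begin{pmatrix}0&1&0\\1&0&0\\0&0&1\end{pmatrix},\ \begin{pmatrix}1&0&0\\0&0&1\\0&1&0\end{pmatrix},\ \begin{pmatrix}0&0&1\\1&0&0\\0&1&0\end{pmatrix},\ \begin{pmatrix}0&1&0\\0&0&1\\1&0&0\end{pmatrix},\ \begin{pmatrix}0&0&1\\0&1&0\\1&0&0\end{pmatrix}; \] the fibre over the identity is determined by the lower-left $2\times2$ submatrix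 (rows $2,3$, columns $1,2$). In the second disjoint union, a unit $a$ in the component indexed by $(i,j,l)$ or $(i,j,l,\delta)$ corresponds to the orbit of $\begin{pmatrix}\pi^i&1\\ \pi^j\tilde a&\pi^l\end{pmatrix}$ with $\tilde a\in A$ a lift of $a$ (when $\delta=k-j$, a lift with $\tilde a\equiv1$ modulo $\pi^{k-j}$), and the elements of $D$ are the valuation matrices $\begin{pmatrix} v(\alpha_{11})&v(\alpha_{12})\\ v(\alpha_{21})&v(\alpha_{22})\end{pmatrix}$ of orbit representatives $\alpha$ for which at least one of $i,j,l$ equals $k$; such an orbit is determined by its valuation matrix.
   Formalization: The printed set D omits the orbits of (0,1;π^j,0) with 1≤j<k (for A=Z/4 there are 5 orbits but 4 indices); the formal D adds the case [j<k, i=l=k], with i,j,l ranging over 1,…,k. *)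

theory Defs
  imports "HOL-Analysis.Analysis" "HOL-Library.Extended_Nat"
begin

section \<open>Local principal ideal rings\<close>

text \<open>The ring \<open>A\<close> is a type of class \<open>comm_ring_1\<close>; an ideal is a submodule of the regular module.\<close>

abbreviation ideal :: "'a::comm_ring_1 set \<Rightarrow> bool" where
  "ideal \<equiv> module.subspace (*)"

abbreviation ideal_gen :: "'a::comm_ring_1 set \<Rightarrow> 'a set" where
  "ideal_gen \<equiv> module.span (*)"

definition maximal_ideal :: "'a::comm_ring_1 set \<Rightarrow> bool" where
  "maximal_ideal M \<longleftrightarrow> ideal M \<and> M \<noteq> UNIV \<and> (\<forall>J. ideal J \<and> M \<subseteq> J \<longrightarrow> J = M \<or> J = UNIV)"

definition local_pir :: "'a::comm_ring_1 set \<Rightarrow> bool" where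
  "local_pir P \<longleftrightarrow>
     (\<forall>M. maximal_ideal M \<longleftrightarrow> M = P) \<and>
     (\<forall>I::'a set. ideal I \<longrightarrow> (\<exists>a. I = ideal_gen {a}))"

primrec ideal_pow :: "'a::comm_ring_1 set \<Rightarrow> nat \<Rightarrow> 'a set" where
  "ideal_pow P 0 = UNIV"
| "ideal_pow P (Suc n) = ideal_gen {x * y | x y. x \<in> P \<and> y \<in> ideal_pow P n}"

text \<open>The convention \<open>P\<^sup>\<infinity> = 0\<close> makes \<open>A / P\<^sup>m\<close> stand for \<open>A\<close> itself when \<open>m = \<infinity>\<close>.\<close>

definition ideal_epow :: "'a::comm_ring_1 set \<Rightarrow> enat \<Rightarrow> 'a set" where
  "ideal_epow P m = (case m of enat n \<Rightarrow> ideal_pow P n | \<infinity> \<Rightarrow> {0})"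

definition ring_length :: "'a::comm_ring_1 set \<Rightarrow> enat" where
  "ring_length P =
     (if \<exists>n>0. ideal_pow P n = {0} then enat (LEAST n. n > 0 \<and> ideal_pow P n = {0}) else \<infinity>)"

definition val :: "'a::comm_ring_1 set \<Rightarrow> 'a \<Rightarrow> enat" where
  "val P x = (if x = 0 then ring_length P else enat (GREATEST r. x \<in> ideal_pow P r))"


section \<open>The quotients \<open>A\<^sub>m = A / P\<^sup>m\<close>\<close>

definition residue_class :: "'a::comm_ring_1 set \<Rightarrow> 'a \<Rightarrow> 'a set" where
  "residue_class I x = {y. y - x \<in> I}"

text \<open>The units of \<open>A\<^sub>m\<close>, as a set of residue classes.\<close>

definition quot_units :: "'a::comm_ring_1 set \<Rightarrow> enat \<Rightarrow> 'a set set" where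
  "quot_units P m =
     {residue_class (ideal_epow P m) a | a.
        \<exists>b. residue_class (ideal_epow P m) (a * b) = residue_class (ideal_epow P m) 1}"

text \<open>Powers of the maximal ideal of \<open>A\<^sub>m\<close> are the images of powers of \<open>P\<close>.\<close>

definition quot_val :: "'a::comm_ring_1 set \<Rightarrow> enat \<Rightarrow> 'a set \<Rightarrow> enat" where
  "quot_val P m X =
     (if X = residue_class (ideal_epow P m) 0 then m
      else enat (GREATEST r. X \<in> residue_class (ideal_epow P m) ` ideal_pow P r))"

text \<open>\<open>{a \<in> A\<^sub>m\<^sup>\<times>. v(a - 1) = \<delta>}\<close>; for a residue class \<open>X\<close>, the class \<open>X - 1\<close> is the translate
  of \<open>X\<close> by \<open>-1\<close>.\<close>

definition quot_units_at :: "'a::comm_ring_1 set \<Rightarrow> enat \<Rightarrow> enat \<Rightarrow> 'a set set" where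
  "quot_units_at P m \<delta> = {X \<in> quot_units P m. quot_val P m ((\<lambda>x. x - 1) ` X) = \<delta>}"


section \<open>Double cosets\<close>

text \<open>Entries are written out because the order on the index types does not agree with the
  numbering of rows: \<open>2 = 0\<close> in type \<open>2\<close> and \<open>3 = 0\<close> in type \<open>3\<close>.\<close>

definition mat22 :: "'a \<Rightarrow> 'a \<Rightarrow> 'a \<Rightarrow> 'a \<Rightarrow> 'a::zero^2^2" where
  "mat22 a b c d = vector [vector [a, b], vector [c, d]]"

definition mat33 :: "'a \<Rightarrow> 'a \<Rightarrow> 'a \<Rightarrow> 'a \<Rightarrow> 'a \<Rightarrow> 'a \<Rightarrow> 'a \<Rightarrow> 'a \<Rightarrow> 'a \<Rightarrow> 'a::zero^3^3" where
  "mat33 a b c d e f g h i = vector [vector [a, b, c], vector [d, e, f], vector [g, h, i]]"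

definition borel2 :: "('a::comm_ring_1^2^2) set" where
  "borel2 = {b. invertible b \<and> b$2$1 = 0}"

definition borel3 :: "('a::comm_ring_1^3^3) set" where
  "borel3 = {b. invertible b \<and> b$2$1 = 0 \<and> b$3$1 = 0 \<and> b$3$2 = 0}"

definition double_coset :: "('a::comm_ring_1^'n^'n) set \<Rightarrow> 'a^'n^'n \<Rightarrow> ('a^'n^'n) set" where
  "double_coset H g = {b ** g ** c | b c. b \<in> H \<and> c \<in> H}"

definition M2_bullet :: "('a::comm_ring_1^2^2) set" where
  "M2_bullet = {\<alpha>. \<alpha>$1$2 dvd 1 \<and> \<not> \<alpha>$1$1 dvd 1 \<and> \<not> \<alpha>$2$1 dvd 1 \<and> \<not> \<alpha>$2$2 dvd 1}"

definition M2_orbits :: "('a::comm_ring_1^2^2) set set" where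
  "M2_orbits = double_coset borel2 ` M2_bullet"

definition GL3_double_cosets :: "('a::comm_ring_1^3^3) set set" where
  "GL3_double_cosets = double_coset borel3 ` {g. invertible g}"

definition lower_left :: "'a::zero^3^3 \<Rightarrow> 'a^2^2" where
  "lower_left g = mat22 (g$2$1) (g$2$2) (g$3$1) (g$3$2)"

definition val_mat :: "'a::comm_ring_1 set \<Rightarrow> 'a^2^2 \<Rightarrow> enat^2^2" where
  "val_mat P \<alpha> = (\<chi> i j. val P (\<alpha>$i$j))"


section \<open>The map to the symmetric group\<close>

text \<open>Matrices over the residue field \<open>A / P\<close> are handled through lifts to \<open>A\<close>, with equality
  replaced by entrywise congruence modulo \<open>P\<close>. The set \<open>borel3_mod P\<close> consists of all lifts of
  upper triangular matrices in \<open>GL\<^sub>3(A / P)\<close>.\<close>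

definition mat_cong :: "'a::comm_ring_1 set \<Rightarrow> 'a^'n^'n \<Rightarrow> 'a^'n^'n \<Rightarrow> bool" where
  "mat_cong I X Y \<longleftrightarrow> (\<forall>i j. X$i$j - Y$i$j \<in> I)"

definition borel3_mod :: "'a::comm_ring_1 set \<Rightarrow> ('a^3^3) set" where
  "borel3_mod P =
     {X. (\<exists>Y. mat_cong P (X ** Y) (mat 1) \<and> mat_cong P (Y ** X) (mat 1)) \<and>
         X$2$1 \<in> P \<and> X$3$1 \<in> P \<and> X$3$2 \<in> P}"

text \<open>The Bruhat cell of \<open>w\<close> over \<open>A / P\<close>, pulled back to \<open>GL\<^sub>3(A)\<close>.\<close>

definition bruhat_cell :: "'a::comm_ring_1 set \<Rightarrow> 'a^3^3 \<Rightarrow> ('a^3^3) set" where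
  "bruhat_cell P w =
     {g. invertible g \<and> (\<exists>X\<in>borel3_mod P. \<exists>Y\<in>borel3_mod P. mat_cong P g (X ** w ** Y))}"

definition bruhat_fibre :: "'a::comm_ring_1 set \<Rightarrow> 'a^3^3 \<Rightarrow> ('a^3^3) set set" where
  "bruhat_fibre P w = double_coset borel3 ` bruhat_cell P w"

definition perm1 :: "'a::comm_ring_1^3^3" where "perm1 = mat33 1 0 0  0 1 0  0 0 1"
definition perm2 :: "'a::comm_ring_1^3^3" where "perm2 = mat33 0 1 0  1 0 0  0 0 1"
definition perm3 :: "'a::comm_ring_1^3^3" where "perm3 = mat33 1 0 0  0 0 1  0 1 0"
definition perm4 :: "'a::comm_ring_1^3^3" where "perm4 = mat33 0 0 1  1 0 0  0 1 0"
definition perm5 :: "'a::comm_ring_1^3^3" where "perm5 = mat33 0 1 0  0 0 1  1 0 0"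
definition perm6 :: "'a::comm_ring_1^3^3" where "perm6 = mat33 0 0 1  0 1 0  1 0 0"


section \<open>The index sets\<close>

text \<open>The subtractions below do not truncate, since \<open>i\<close> and \<open>l\<close> are always less than \<open>j\<close>.\<close>

definition eps :: "nat \<Rightarrow> nat \<Rightarrow> nat \<Rightarrow> nat" where
  "eps i j l = min (min (j - i) (j - l)) (min i l)"

text \<open>The displayed definition of \<open>D\<close> in the source has only the first three of the following
  four cases, with the valuations \<open>i\<close>, \<open>j\<close>, \<open>l\<close> of non-units ranging over \<open>{1..k}\<close>. The fourth
  case \<open>i = l = k\<close>, \<open>j < k\<close> has to be added. It is the valuation matrix of the orbit of
  \<open>(0, 1; \<pi>\<^sup>j, 0)\<close>. Every matrix in that orbit has lower left entry of valuation \<open>j < k\<close> and both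
  diagonal entries divisible by \<open>\<pi>\<^sup>j\<close>, whereas every orbit listed in the source contains
  a matrix whose lower left entry has valuation \<open>k\<close> or some diagonal entry of which has smaller
  valuation than the lower left one.\<close>

definition D_set :: "enat \<Rightarrow> (enat^2^2) set" where
  "D_set k =
     {mat22 i 0 j l | i j l.
        {i, j, l} \<subseteq> {1..k} \<and>
        (j = k \<or> (i < j \<and> j < k \<and> l = k) \<or> (l < j \<and> j < k \<and> i = k) \<or>
         (j < k \<and> i = k \<and> l = k))}"

text \<open>Differences and minima are taken in \<^typ>\<open>enat\<close>, where \<open>\<infinity> - j = \<infinity>\<close>; for \<open>k = \<infinity>\<close> the
  index \<open>j\<close> runs over all integers \<open>\<ge> 2\<close> and \<open>\<delta>\<close> over \<open>0, 1, \<dots>, \<infinity>\<close>.\<close>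

definition generic_index :: "'a::comm_ring_1 set \<Rightarrow> enat \<Rightarrow> nat \<Rightarrow> ((nat \<times> nat) \<times> 'a set) set" where
  "generic_index P k j =
     (SIGMA (i, l) : {(i, l). i \<in> {1..j-1} \<and> l \<in> {1..j-1} \<and> i + l \<noteq> j}.
        quot_units P (min (enat (eps i j l)) (k - enat j)))"

definition special_index ::
    "'a::comm_ring_1 set \<Rightarrow> enat \<Rightarrow> nat \<Rightarrow> ((nat \<times> nat) \<times> enat \<times> 'a set) set" where
  "special_index P k j =
     (SIGMA (i, l) : {(i, l). i \<in> {1..j-1} \<and> l \<in> {1..j-1} \<and> i + l = j}.
        SIGMA \<delta> : {0..k - enat j}.
          quot_units_at P (min (enat (eps i j l) + \<delta>) (k - enat j)) \<delta>)"

type_synonym 'a orbit_index =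
  "(nat \<times> ((nat \<times> nat) \<times> 'a set + (nat \<times> nat) \<times> enat \<times> 'a set)) + enat^2^2"

definition orbit_indices :: "'a::comm_ring_1 set \<Rightarrow> enat \<Rightarrow> 'a orbit_index set" where
  "orbit_indices P k =
     (SIGMA j : {j. 2 \<le> j \<and> enat j < k}. generic_index P k j <+> special_index P k j) <+> D_set k"

abbreviation generic :: "nat \<Rightarrow> nat \<Rightarrow> nat \<Rightarrow> 'a set \<Rightarrow> 'a orbit_index" where
  "generic i j l a \<equiv> Inl (j, Inl ((i, l), a))"

abbreviation special :: "nat \<Rightarrow> nat \<Rightarrow> nat \<Rightarrow> enat \<Rightarrow> 'a set \<Rightarrow> 'a orbit_index" where
  "special i j l \<delta> a \<equiv> Inl (j, Inr ((i, l), \<delta>, a))"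

abbreviation degenerate :: "enat^2^2 \<Rightarrow> 'a orbit_index" where
  "degenerate \<equiv> Inr"


section \<open>The two parametrisations\<close>

text \<open>A bijection is onto the disjoint union, with its six pieces the images of the fibres. On the
  first piece it is prescribed; on the others it is any bijection.\<close>

definition parametrises_GL3 ::
    "'a::comm_ring_1 set \<Rightarrow>
     (('a^3^3) set \<Rightarrow>
        ('a^2^2) set + (enat \<times> enat) + (enat \<times> enat) + enat + enat + unit) \<Rightarrow> bool" where
  "parametrises_GL3 P \<Phi> \<longleftrightarrow>
     bij_betw \<Phi> GL3_double_cosets
       (M2_orbits <+> (val P ` P \<times> val P ` P) <+> (val P ` P \<times> val P ` P) <+>
        val P ` P <+> val P ` P <+> {()}) \<and>
     \<Phi> ` bruhat_fibre P perm1 = Inl ` M2_orbits \<and>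
     \<Phi> ` bruhat_fibre P perm2 = (Inr \<circ> Inl) ` (val P ` P \<times> val P ` P) \<and>
     \<Phi> ` bruhat_fibre P perm3 = (Inr \<circ> Inr \<circ> Inl) ` (val P ` P \<times> val P ` P) \<and>
     \<Phi> ` bruhat_fibre P perm4 = (Inr \<circ> Inr \<circ> Inr \<circ> Inl) ` (val P ` P) \<and>
     \<Phi> ` bruhat_fibre P perm5 = (Inr \<circ> Inr \<circ> Inr \<circ> Inr \<circ> Inl) ` (val P ` P) \<and>
     \<Phi> ` bruhat_fibre P perm6 = (Inr \<circ> Inr \<circ> Inr \<circ> Inr \<circ> Inr) ` {()} \<and>
     (\<forall>g \<in> bruhat_cell P perm1.
        \<Phi> (double_coset borel3 g) = Inl (double_coset borel2 (lower_left g)))"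

text \<open>A lift of a residue class is an element of it.\<close>

definition parametrises_M2 ::
    "'a::comm_ring_1 set \<Rightarrow> 'a \<Rightarrow> enat \<Rightarrow> ('a orbit_index \<Rightarrow> ('a^2^2) set) \<Rightarrow> bool" where
  "parametrises_M2 P \<pi> k \<Psi> \<longleftrightarrow>
     bij_betw \<Psi> (orbit_indices P k) M2_orbits \<and>
     (\<forall>i j l a a'. generic i j l a \<in> orbit_indices P k \<and> a' \<in> a \<longrightarrow>
        \<Psi> (generic i j l a) = double_coset borel2 (mat22 (\<pi> ^ i) 1 (\<pi> ^ j * a') (\<pi> ^ l))) \<and>
     (\<forall>i j l \<delta> a a'. special i j l \<delta> a \<in> orbit_indices P k \<and> a' \<in> a \<and>
          (\<delta> = k - enat j \<longrightarrow> a' - 1 \<in> ideal_epow P (k - enat j)) \<longrightarrow>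
        \<Psi> (special i j l \<delta> a) = double_coset borel2 (mat22 (\<pi> ^ i) 1 (\<pi> ^ j * a') (\<pi> ^ l))) \<and>
     (\<forall>d \<in> D_set k.
        {double_coset borel2 \<alpha> | \<alpha>. \<alpha> \<in> M2_bullet \<and> val_mat P \<alpha> = d} = {\<Psi> (degenerate d)})"

end

theory Submission
  imports Defs
begin

text \<open>Every nonzero element of \<open>A\<close> is a unit times a power of \<open>\<pi>\<close> (this needs Krull's intersection
  theorem when \<open>k = \<infinity>\<close>), so divisibility is comparison of valuations.

  On \<open>GL\<^sub>3(A)\<close> the lower left entry and the lower left \<open>2 \<times> 2\<close> minor are multiplied by units under
  the action of \<open>B \<times> B\<close>. Their residues, together with those of the entries \<open>g\<^sub>3\<^sub>2\<close> and \<open>g\<^sub>2\<^sub>1\<close>,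
  determine the Bruhat cell, and elimination with the unit pivots of the cell leaves a normal form
  which depends only on the valuations of the entry and the minor, or, in the identity cell, only
  on the lower left block.

  An orbit \<open>B\<^sub>2 \<alpha> B\<^sub>2\<close> determines the ideals generated by \<open>\<alpha>\<^sub>2\<^sub>1\<close>, by \<open>\<alpha>\<^sub>1\<^sub>1, \<alpha>\<^sub>2\<^sub>1\<close> and by
  \<open>\<alpha>\<^sub>2\<^sub>2, \<alpha>\<^sub>2\<^sub>1\<close>, hence \<open>i\<close>, \<open>j\<close> and \<open>l\<close>. For fixed \<open>i, l < j < k\<close>, the orbits of
  \<open>(\<pi>\<^sup>i, 1; \<pi>\<^sup>j u, \<pi>\<^sup>l)\<close> and \<open>(\<pi>\<^sup>i, 1; \<pi>\<^sup>j u', \<pi>\<^sup>l)\<close> agree if and only if \<open>\<pi>\<^sup>j (u' - u)\<close> lies in the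
  ideal generated by \<open>\<pi>\<^sup>j (u \<pi>\<^sup>j\<^sup>-\<^sup>i - \<pi>\<^sup>l)\<close> and \<open>\<pi>\<^sup>j (u \<pi>\<^sup>j\<^sup>-\<^sup>l - \<pi>\<^sup>i)\<close>. The two generators in brackets have
  minimal valuation \<open>\<epsilon>\<close> when \<open>i + l \<noteq> j\<close>, while for \<open>i + l = j\<close> both contain the factor \<open>u - 1\<close>
  and the minimum is \<open>\<epsilon> + v(u - 1)\<close>.\<close>


section \<open>Divisibility in local principal ideal rings\<close>

lemma module_mult: "module ((*) :: 'a::comm_ring_1 \<Rightarrow> 'a \<Rightarrow> 'a)"
  by unfold_locales (simp_all add: algebra_simps)

lemma ideal_gen_singleton: "ideal_gen {a} = {x. a dvd x}" for a :: "'a::comm_ring_1"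
  by (auto simp: module.span_singleton[OF module_mult] dvd_def mult.commute)

lemma ideal_eq_UNIV_iff:
  assumes "ideal I"
  shows "I = UNIV \<longleftrightarrow> 1 \<in> I"
proof
  assume "1 \<in> I"
  then have "x * 1 \<in> I" for x using assms by (rule module.subspace_scale[OF module_mult, rotated])
  then show "I = UNIV" by auto
qed simp

lemma ideal_Union_chain:
  assumes chain: "subset.chain A C" and "C \<noteq> {}" and A: "A \<subseteq> Collect ideal"
  shows "ideal (\<Union>C)"
proof -
  have ideal: "I \<in> C \<Longrightarrow> ideal I" for I
    using chain A by (auto simp: subset.chain_def)
  have total: "I \<subseteq> J \<or> J \<subseteq> I" if "I \<in> C" "J \<in> C" for I J
    using chain that by (auto simp: subset_chain_def)
  show ?thesis
    unfolding module.subspace_def[OF module_mult]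
  proof (intro conjI ballI allI)
    show "0 \<in> \<Union>C" using ideal \<open>C \<noteq> {}\<close> module.subspace_0[OF module_mult] by blast
    show "x + y \<in> \<Union>C" if "x \<in> \<Union>C" "y \<in> \<Union>C" for x y
      using that ideal total by (meson UnionE UnionI module.subspace_add[OF module_mult] subsetD)
    show "c * x \<in> \<Union>C" if "x \<in> \<Union>C" for c x
      using that ideal module.subspace_scale[OF module_mult] by blast
  qed
qed

text \<open>Zorn's lemma, applied to the ideals that contain \<open>x\<close> but not
  \<open>1\<close>. It turns the uniqueness of the maximal ideal \<open>P\<close> into the statement
  that \<open>P\<close> consists of the nonunits.\<close>

lemma nonunit_in_maximal_ideal:
  fixes x :: "'a::comm_ring_1"
  assumes "\<not> x dvd 1"
  obtains M where "maximal_ideal M" "x \<in> M"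
proof -
  let ?A = "{I. ideal I \<and> x \<in> I \<and> 1 \<notin> I}"
  have "\<exists>M\<in>?A. \<forall>X\<in>?A. M \<subseteq> X \<longrightarrow> X = M"
  proof (rule subset_Zorn_nonempty)
    have "ideal {y. x dvd y}"
      using module.subspace_span[OF module_mult, of "{x}"] by (simp add: ideal_gen_singleton)
    then have "{y. x dvd y} \<in> ?A" using assms by simp
    then show "?A \<noteq> {}" by (metis empty_iff)
    show "\<Union>C \<in> ?A" if "C \<noteq> {}" "subset.chain ?A C" for C
      
    proof -
      have "ideal (\<Union>C)"
        using that by (intro ideal_Union_chain[of ?A]) auto
      moreover have "C \<subseteq> ?A" using that(2) by (simp add: subset_chain_def)
      ultimately show ?thesis using that(1) by blast
    qed
  qed
  then obtain M where M: "M \<in> ?A" "\<And>X. X \<in> ?A \<Longrightarrow> M \<subseteq> X \<Longrightarrow> X = M" by blast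
  have "maximal_ideal M"
    unfolding maximal_ideal_def
  proof (intro conjI allI impI)
    show "ideal M" "M \<noteq> UNIV" using M(1) by auto
    fix J assume J: "ideal J \<and> M \<subseteq> J"
    show "J = M \<or> J = UNIV"
      using M(1) M(2)[of J] J ideal_eq_UNIV_iff[of J] by auto
  qed
  with M that show ?thesis by blast
qed

lemma unitE:
  fixes u :: "'a::comm_ring_1"
  assumes "u dvd 1"
  obtains v where "u * v = 1" "v dvd 1"
proof -
  from assms obtain v where v: "1 = u * v" by (rule dvdE)
  then have "v dvd 1" by (metis dvd_triv_right)
  with v that show ?thesis by simp
qed

lemma mult_unit_eq_0D:
  fixes u :: "'a::comm_ring_1"
  assumes "x * u = 0" "u dvd 1"
  shows "x = 0"
proof -
  obtain v where "u * v = 1" using assms(2) by (rule unitE)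
  then have "x = x * u * v" by (simp add: mult.assoc)
  then show ?thesis using assms(1) by simp
qed

lemma dvd_mult_unit_iff':
  fixes u :: "'a::comm_ring_1"
  assumes "u dvd 1"
  shows "x dvd y * u \<longleftrightarrow> x dvd y" "x * u dvd y \<longleftrightarrow> x dvd y"
proof -
  obtain v where v: "u * v = 1" using assms by (rule unitE)
  have y: "z = z * u * v" for z using v by (simp add: mult.assoc)
  show "x dvd y * u \<longleftrightarrow> x dvd y" using y[of y] by (metis dvd_mult2)
  show "x * u dvd y \<longleftrightarrow> x dvd y"
    using y[of x] by (metis dvd_mult_left dvd_triv_left dvd_trans)
qed

lemma units_mult: "x * y dvd 1 \<longleftrightarrow> x dvd 1 \<and> y dvd (1::'a::comm_ring_1)"
proof
  show "x dvd 1 \<and> y dvd 1" if "x * y dvd 1"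
    using that by (meson dvd_mult_left dvd_mult_right)
  show "x * y dvd 1" if "x dvd 1 \<and> y dvd 1"
    using that mult_dvd_mono[of x 1 y 1] by simp
qed

section \<open>Local principal ideal rings with a chosen uniformizer\<close>

locale uniformized_local_pir =
  fixes P :: "'a::comm_ring_1 set" and \<pi> :: 'a and k :: enat
  assumes local_pir: "local_pir P"
    and P_gen: "P = ideal_gen {\<pi>}"
    and length: "ring_length P = k"
begin

lemma maximal_P: "maximal_ideal P"
  using local_pir by (simp add: local_pir_def)

lemma P_iff_dvd: "x \<in> P \<longleftrightarrow> \<pi> dvd x"
  by (simp add: P_gen ideal_gen_singleton)

lemma unit_iff: "x dvd 1 \<longleftrightarrow> \<not> \<pi> dvd x"
proof
  have "1 \<notin> P"
    using maximal_P ideal_eq_UNIV_iff by (auto simp: maximal_ideal_def)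
  then show "\<not> \<pi> dvd x" if "x dvd 1"
    using that dvd_trans P_iff_dvd by blast
  show "x dvd 1" if "\<not> \<pi> dvd x"
    using that nonunit_in_maximal_ideal local_pir
    by (metis P_iff_dvd local_pir_def)
qed

lemma pi_nonunit: "\<not> \<pi> dvd 1" and one_neq_zero': "(1::'a) \<noteq> 0"
  using unit_iff[of \<pi>] unit_iff[of 0] by auto

lemma unit_add:
  assumes "u dvd 1" "\<pi> dvd x"
  shows "u + x dvd 1"
  using assms by (simp add: unit_iff dvd_add_left_iff)

lemma nonunit_mult: "\<pi> dvd x * y \<longleftrightarrow> \<pi> dvd x \<or> \<pi> dvd y"
  using units_mult[of x y] unit_iff by blast

text \<open>By induction, the span of products that defines each power is generated by the single
  product \<open>\<pi> * \<pi> ^ n\<close>.\<close>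

lemma ideal_pow_iff: "x \<in> ideal_pow P n \<longleftrightarrow> \<pi> ^ n dvd x"
proof (induction n arbitrary: x)
  case (Suc n)
  have *: "ideal_gen {x * y |x y. x \<in> P \<and> y \<in> ideal_pow P n} = ideal_gen {\<pi> * \<pi> ^ n}"
  proof (rule module.span_eq[OF module_mult, THEN iffD2], intro conjI subsetI)
    fix z assume "z \<in> {x * y |x y. x \<in> P \<and> y \<in> ideal_pow P n}"
    then show "z \<in> ideal_gen {\<pi> * \<pi> ^ n}"
      by (auto simp: ideal_gen_singleton Suc P_iff_dvd mult_dvd_mono)
  next
    fix z assume "z \<in> {\<pi> * \<pi> ^ n}"
    moreover have "\<pi> \<in> P" "\<pi> ^ n \<in> ideal_pow P n" by (simp_all add: Suc P_iff_dvd)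
    ultimately have "z \<in> {x * y |x y. x \<in> P \<and> y \<in> ideal_pow P n}" by blast
    then show "z \<in> ideal_gen {x * y |x y. x \<in> P \<and> y \<in> ideal_pow P n}"
      by (rule module.span_base[OF module_mult])
  qed
  show ?case by (simp add: * ideal_gen_singleton)
qed simp

text \<open>Krull's intersection theorem. The annihilators of the powers of \<open>\<pi>\<close> form an increasing
  chain whose union is principal, so they stabilise; this gives \<open>J = \<pi> J\<close> for the intersection
  \<open>J\<close> of the powers of \<open>P\<close>, and the generator of \<open>J\<close> is then killed by a unit.\<close>

lemma eq_0_if_all_powers_dvd:
  assumes "\<And>n. \<pi> ^ n dvd x"
  shows "x = 0"
proof -
  define Ann where "Ann = {y. \<exists>n. \<pi> ^ n * y = 0}"
  have "ideal Ann"
    unfolding module.subspace_def[OF module_mult]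
  proof (intro conjI ballI allI)
    show "0 \<in> Ann" by (simp add: Ann_def)
    show "c * y \<in> Ann" if y: "y \<in> Ann" for c y
    proof -
      obtain n where "\<pi> ^ n * y = 0" using y unfolding Ann_def by blast
      then have "\<pi> ^ n * (c * y) = 0" by (simp add: mult.left_commute[of _ c])
      then show ?thesis unfolding Ann_def by blast
    qed
    show "y + z \<in> Ann" if yz: "y \<in> Ann" "z \<in> Ann" for y z
    proof -
      obtain m n where "\<pi> ^ m * y = 0" "\<pi> ^ n * z = 0"
        using yz unfolding Ann_def by blast
      moreover have "\<pi> ^ (m + n) * (y + z) = \<pi> ^ n * (\<pi> ^ m * y) + \<pi> ^ m * (\<pi> ^ n * z)"
        by (simp add: power_add algebra_simps)
      ultimately have "\<pi> ^ (m + n) * (y + z) = 0" by simp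
      then show ?thesis by (auto simp: Ann_def)
    qed
  qed
  then obtain a where a: "Ann = {y. a dvd y}"
    using local_pir by (auto simp: local_pir_def ideal_gen_singleton)
  then have "a \<in> Ann" by simp
  then obtain N where N: "\<pi> ^ N * a = 0" by (auto simp: Ann_def)
  have stable: "\<pi> ^ N * y = 0" if "\<pi> ^ n * y = 0" for n y
  proof -
    have "y \<in> Ann" using that by (auto simp: Ann_def)
    then obtain b where "y = a * b" using a by (auto simp: dvd_def)
    then show ?thesis using N by (simp flip: mult.assoc)
  qed
  define J where "J = {y. \<forall>n. \<pi> ^ n dvd y}"
  have "ideal J"
    by (auto simp: module.subspace_def[OF module_mult] J_def)
  then obtain z where z: "J = {y. z dvd y}"
    using local_pir by (auto simp: local_pir_def ideal_gen_singleton)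
  then have "z \<in> J" by simp
  then have "\<pi> ^ Suc N dvd z" unfolding J_def by blast
  then obtain y where y: "z = \<pi> ^ Suc N * y" by (rule dvdE)
  \<comment> \<open>\<open>stable\<close> cancels one factor \<open>\<pi>\<close> as long as
    \<open>\<pi> ^ N\<close> is kept. This puts \<open>\<pi> ^ N * y\<close>, and not just
    \<open>z = \<pi> * (\<pi> ^ N * y)\<close>, into \<open>J\<close>.\<close>
  have "\<pi> ^ m dvd \<pi> ^ N * y" for m
  proof -
    have "\<pi> ^ (Suc N + m) dvd z" using \<open>z \<in> J\<close> unfolding J_def by blast
    then obtain t where "z = \<pi> ^ (Suc N + m) * t" by (rule dvdE)
    with y have "\<pi> ^ Suc N * (y - \<pi> ^ m * t) = 0"
      by (simp add: algebra_simps power_add)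
    then have "\<pi> ^ N * (y - \<pi> ^ m * t) = 0" by (rule stable)
    then have "\<pi> ^ N * y = \<pi> ^ m * (\<pi> ^ N * t)" by (simp add: algebra_simps)
    then show ?thesis by simp
  qed
  then have "\<pi> ^ N * y \<in> J" unfolding J_def by blast
  then have "z dvd \<pi> ^ N * y" using z by simp
  then obtain c where c: "\<pi> ^ N * y = z * c" by (rule dvdE)
  have "z * (1 - \<pi> * c) = 0" using y c by (simp add: algebra_simps)
  moreover have "1 - \<pi> * c dvd 1" using unit_add[of 1 "- (\<pi> * c)"] by simp
  ultimately have "z = 0" by (rule mult_unit_eq_0D)
  moreover have "x \<in> J" using assms by (simp add: J_def)
  ultimately show ?thesis using z by simp
qed

text \<open>Vanishing powers are upward closed and \<open>\<pi> ^ 0 = 1\<close> never vanishes, so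
  the least positive exponent is a threshold. For \<open>k = \<infinity>\<close> the right-hand side
  is always false, which lets one formula serve both cases.\<close>

lemma power_eq_0_iff: "\<pi> ^ n = 0 \<longleftrightarrow> k \<le> enat n"
proof -
  have *: "ideal_pow P m = {0} \<longleftrightarrow> \<pi> ^ m = 0" for m
  proof
    show "\<pi> ^ m = 0" if "ideal_pow P m = {0}"
      using that ideal_pow_iff[of "\<pi> ^ m" m] by simp
    show "ideal_pow P m = {0}" if "\<pi> ^ m = 0"
      using that by (simp add: set_eq_iff ideal_pow_iff)
  qed
  have "k = (if \<exists>n>0. \<pi> ^ n = 0 then enat (LEAST n. n > 0 \<and> \<pi> ^ n = 0) else \<infinity>)"
    using length unfolding ring_length_def * by (rule sym)
  note k = this
  show ?thesis
  proof (cases "\<exists>n>0. \<pi> ^ n = 0")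
    case True
    then have least: "0 < (LEAST n. n > 0 \<and> \<pi> ^ n = 0)" "\<pi> ^ (LEAST n. n > 0 \<and> \<pi> ^ n = 0) = 0"
      using LeastI_ex[of "\<lambda>n. n > 0 \<and> \<pi> ^ n = 0"] by auto
    have "(LEAST n. n > 0 \<and> \<pi> ^ n = 0) \<le> n" if "\<pi> ^ n = 0"
    proof -
      have "n > 0" using that one_neq_zero' by (cases n) auto
      with that show ?thesis by (simp add: Least_le)
    qed
    moreover have "\<pi> ^ n = 0" if "(LEAST n. n > 0 \<and> \<pi> ^ n = 0) \<le> n"
      using le_imp_power_dvd[OF that, of \<pi>] least by simp
    ultimately show ?thesis using k True by auto
  next
    case False
    then have "\<pi> ^ n \<noteq> 0" using one_neq_zero' by (metis gr0I power_0)
    then show ?thesis using k False by simp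
  qed
qed

text \<open>By the intersection theorem, divisibility of a nonzero element by powers of
  \<open>\<pi>\<close> stops somewhere; after the largest power is split off, the cofactor is prime
  to \<open>\<pi>\<close> and hence a unit.\<close>

lemma decompose:
  assumes "x \<noteq> 0"
  obtains r u where "x = \<pi> ^ r * u" "u dvd 1" "enat r < k"
proof -
  obtain n where n: "\<not> \<pi> ^ n dvd x" using assms eq_0_if_all_powers_dvd by blast
  define r where "r = (GREATEST r. \<pi> ^ r dvd x)"
  have bound: "m \<le> n" if "\<pi> ^ m dvd x" for m
    using that n by (meson dvd_trans le_imp_power_dvd nle_le)
  have r: "\<pi> ^ r dvd x"
    unfolding r_def by (rule GreatestI_nat[of _ 0 n]) (use bound in auto)
  then obtain u where u: "x = \<pi> ^ r * u" by (rule dvdE)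
  have "\<not> \<pi> dvd u"
  proof
    assume "\<pi> dvd u"
    then have "\<pi> ^ Suc r dvd x" by (auto simp: u mult.commute intro: mult_dvd_mono)
    then have "Suc r \<le> r"
      unfolding r_def using bound by (intro Greatest_le_nat) auto
    then show False by simp
  qed
  moreover have "enat r < k" using assms u power_eq_0_iff[of r] by (auto simp: not_le)
  ultimately show ?thesis using u that unit_iff by blast
qed

lemma length_pos: "0 < k"
  using power_eq_0_iff[of 0] one_neq_zero' by (simp add: zero_enat_def not_le)

lemma length_ge_1: "1 \<le> k"
  using length_pos by (simp add: ileI1 one_eSuc)

text \<open>Divisibility by a higher power gives \<open>\<pi> ^ n * (1 - \<pi> * c) = 0\<close> with
  a unit in the bracket, so it occurs only if \<open>\<pi> ^ n\<close> is already zero.\<close>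

lemma power_dvd_power_unit_iff:
  assumes "u dvd 1"
  shows "\<pi> ^ m dvd \<pi> ^ n * u \<longleftrightarrow> m \<le> n \<or> k \<le> enat n"
proof
  assume "\<pi> ^ m dvd \<pi> ^ n * u"
  then have dvd: "\<pi> ^ m dvd \<pi> ^ n" using assms by (simp add: dvd_mult_unit_iff')
  show "m \<le> n \<or> k \<le> enat n"
  proof (rule ccontr)
    assume *: "\<not> (m \<le> n \<or> k \<le> enat n)"
    then have "\<pi> ^ Suc n dvd \<pi> ^ n"
      using dvd by (meson Suc_leI dvd_trans le_imp_power_dvd not_le)
    then obtain c where "\<pi> ^ n = \<pi> ^ Suc n * c" by (rule dvdE)
    then have "\<pi> ^ n * (1 - \<pi> * c) = 0" by (simp add: algebra_simps)
    moreover have "1 - \<pi> * c dvd 1" using unit_add[of 1 "- (\<pi> * c)"] by simp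
    ultimately have "\<pi> ^ n = 0" by (rule mult_unit_eq_0D)
    then show False using * power_eq_0_iff by blast
  qed
next
  assume "m \<le> n \<or> k \<le> enat n"
  then show "\<pi> ^ m dvd \<pi> ^ n * u"
    using power_eq_0_iff[of n] by (auto simp: le_imp_power_dvd)
qed

section \<open>The valuation\<close>

lemma val_0 [simp]: "val P 0 = k"
  by (simp add: val_def length)

lemma val_power_unit:
  assumes "u dvd 1"
  shows "val P (\<pi> ^ n * u) = min (enat n) k"
proof (cases "k \<le> enat n")
  case True
  then have "\<pi> ^ n = 0" by (simp add: power_eq_0_iff)
  with True show ?thesis by (simp add: min_def)
next
  case False
  have "\<pi> ^ n * u \<noteq> 0"
    using False power_eq_0_iff assms mult_unit_eq_0D by blast
  moreover have "(GREATEST r. \<pi> ^ r dvd \<pi> ^ n * u) = n"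
    using False by (intro Greatest_equality) (auto simp: power_dvd_power_unit_iff[OF assms])
  ultimately show ?thesis
    using False by (simp add: val_def ideal_pow_iff min.absorb1)
qed

lemma val_power: "val P (\<pi> ^ n) = min (enat n) k"
  using val_power_unit[of 1 n] by simp

lemma val_le: "val P x \<le> k"
  by (cases "x = 0") (auto elim: decompose simp: val_power_unit)

text \<open>The convention \<open>val P 0 = k\<close> keeps this true when \<open>x\<close> or
  \<open>y\<close> is zero, so that all questions about ideals become comparisons in
  \<open>enat\<close>.\<close>

lemma dvd_iff_val: "x dvd y \<longleftrightarrow> val P x \<le> val P y"
proof (cases "x = 0 \<or> y = 0")
  case True
  moreover have "k \<le> val P y \<longleftrightarrow> y = 0"
  proof (cases "y = 0")
    case False
    then obtain r u where "y = \<pi> ^ r * u" "u dvd 1" "enat r < k" by (rule decompose)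
    with False show ?thesis by (auto simp: val_power_unit)
  qed simp
  ultimately show ?thesis using val_le by auto
next
  case False
  then obtain r u s v where x: "x = \<pi> ^ r * u" "u dvd 1" and rs: "enat r < k" "enat s < k"
    and y: "y = \<pi> ^ s * v" "v dvd 1"
    by (metis decompose)
  have "\<pi> ^ r * u dvd y \<longleftrightarrow> \<pi> ^ r dvd y"
    using x(2) by (rule dvd_mult_unit_iff')
  then show ?thesis
    using x y rs by (auto simp: power_dvd_power_unit_iff val_power_unit)
qed

lemma val_eq_iff_dvd: "val P x = val P y \<longleftrightarrow> x dvd y \<and> y dvd x"
  using dvd_iff_val by auto

lemma val_eq_length_iff: "val P x = k \<longleftrightarrow> x = 0"
  using val_eq_iff_dvd[of x 0] by auto

lemma val_mult_unit:
  assumes "u dvd 1"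
  shows "val P (u * x) = val P x" "val P (x * u) = val P x"
proof -
  show "val P (x * u) = val P x"
    using assms by (simp add: val_eq_iff_dvd dvd_mult_unit_iff')
  then show "val P (u * x) = val P x" by (simp add: mult.commute)
qed

text \<open>With zero divisors present, mutual divisibility does not by itself supply a unit. Here
  nonzero elements of equal valuation are units times the same power of \<open>\<pi>\<close>, and
  the quotient of the two units serves.\<close>

lemma val_eqE:
  assumes "val P x = val P y"
  obtains u where "u dvd 1" "y = u * x"
proof (cases "x = 0")
  case True
  then show ?thesis using that[of 1] assms val_eq_length_iff[of y] by simp
next
  case False
  moreover from this have "y \<noteq> 0" using assms val_eq_length_iff val_0 by metis
  ultimately obtain r u s v where x: "x = \<pi> ^ r * u" "u dvd 1" and rs: "enat r < k" "enat s < k"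
    and y: "y = \<pi> ^ s * v" "v dvd 1"
    by (metis decompose)
  then have "r = s" using assms by (simp add: val_power_unit)
  obtain u' where u': "u * u' = 1" "u' dvd 1" using x(2) by (rule unitE)
  have "y = u * u' * y" using u' by simp
  then have "y = (u' * v) * x" using x y \<open>r = s\<close> by (simp add: ac_simps)
  moreover have "u' * v dvd 1" using y u' by (simp add: units_mult)
  ultimately show ?thesis using that by blast
qed

lemma nonunit_iff_val: "\<pi> dvd x \<longleftrightarrow> 1 \<le> val P x"
proof -
  have "val P \<pi> = 1" using val_power[of 1] length_ge_1 by (simp add: min_def one_enat_def)
  then show ?thesis by (simp add: dvd_iff_val)
qed

lemma unit_iff_val: "x dvd 1 \<longleftrightarrow> val P x = 0"
  using unit_iff nonunit_iff_val by (metis iless_eSuc0 not_le one_eSuc)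

lemma val_surj:
  assumes "n \<le> k"
  obtains x where "val P x = n"
proof (cases n)
  case (enat m)
  with assms that[of "\<pi> ^ m"] show ?thesis by (simp add: val_power)
next
  case infinity
  with assms that[of 0] show ?thesis by simp
qed

lemma ideal_epow_iff:
  assumes "m \<le> k"
  shows "x \<in> ideal_epow P m \<longleftrightarrow> m \<le> val P x"
proof (cases m)
  case (enat n)
  then show ?thesis using assms by (simp add: ideal_epow_def ideal_pow_iff dvd_iff_val val_power)
next
  case infinity
  then have "k = \<infinity>" using assms by simp
  with infinity show ?thesis using val_eq_length_iff[of x] by (simp add: ideal_epow_def)
qed

lemma val_power_mult: "val P (\<pi> ^ j * x) = min (enat j + val P x) k"
proof (cases "x = 0")
  case True
  then show ?thesis by (simp add: min.absorb2 add_increasing)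
next
  case False
  then obtain r u where "x = \<pi> ^ r * u" "u dvd 1" "enat r < k" by (rule decompose)
  then show ?thesis using val_power_unit[of u "j + r"] val_power_unit[of u r]
    by (simp add: power_add mult.assoc)
qed

end


section \<open>Upper triangular matrices and their double cosets\<close>

text \<open>Isolates the subgroup properties under which double cosets are equivalence classes, for
  common use with \<open>borel2\<close> and \<open>borel3\<close>.\<close>

definition matrix_group :: "('a::comm_ring_1^'n^'n) set \<Rightarrow> bool" where
  "matrix_group H \<longleftrightarrow> mat 1 \<in> H \<and> (\<forall>b\<in>H. \<forall>c\<in>H. b ** c \<in> H) \<and>
     (\<forall>b\<in>H. \<exists>b'\<in>H. b ** b' = mat 1 \<and> b' ** b = mat 1)"

lemma mem_double_coset_self:
  assumes "matrix_group H"
  shows "g \<in> double_coset H g"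
proof -
  have "g = mat 1 ** g ** mat 1" by (simp add: matrix_mul_lid matrix_mul_rid)
  moreover have "mat 1 \<in> H" using assms by (simp add: matrix_group_def)
  ultimately show ?thesis unfolding double_coset_def by blast
qed

lemma double_coset_subset:
  assumes "matrix_group H" "h \<in> double_coset H g"
  shows "double_coset H h \<subseteq> double_coset H g"
proof
  fix x assume "x \<in> double_coset H h"
  then obtain b c where bc: "b \<in> H" "c \<in> H" "x = b ** h ** c" by (auto simp: double_coset_def)
  obtain b' c' where bc': "b' \<in> H" "c' \<in> H" "h = b' ** g ** c'"
    using assms(2) by (auto simp: double_coset_def)
  have "x = (b ** b') ** g ** (c' ** c)" by (simp add: bc bc' matrix_mul_assoc)
  moreover have "b ** b' \<in> H" "c' ** c \<in> H" using assms(1) bc bc' by (auto simp: matrix_group_def)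
  ultimately show "x \<in> double_coset H g" unfolding double_coset_def by blast
qed

lemma double_coset_sym:
  assumes H: "matrix_group H" and "h \<in> double_coset H g"
  shows "g \<in> double_coset H h"
proof -
  obtain b c where bc: "b \<in> H" "c \<in> H" "h = b ** g ** c"
    using assms(2) by (auto simp: double_coset_def)
  obtain b' c' where b': "b' \<in> H" "b' ** b = mat 1" and c': "c' \<in> H" "c ** c' = mat 1"
    using H bc unfolding matrix_group_def by blast
  have "b' ** h ** c' = (b' ** b) ** g ** (c ** c')" by (simp add: bc matrix_mul_assoc)
  then have "g = b' ** h ** c'" by (simp add: b' c' matrix_mul_lid matrix_mul_rid)
  then show ?thesis using b' c' unfolding double_coset_def by blast
qed

lemma double_coset_eq_iff:
  assumes "matrix_group H"
  shows "double_coset H g = double_coset H h \<longleftrightarrow> h \<in> double_coset H g"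
  using double_coset_subset[OF assms] double_coset_sym[OF assms] mem_double_coset_self[OF assms]
  by blast

section \<open>Explicit matrices of size two and three, and the Borel subgroups\<close>

lemma mat33_nth [simp]:
  "mat33 a b c d e f g h i $ 1 $ 1 = a" "mat33 a b c d e f g h i $ 1 $ 2 = b"
  "mat33 a b c d e f g h i $ 1 $ 3 = c" "mat33 a b c d e f g h i $ 2 $ 1 = d"
  "mat33 a b c d e f g h i $ 2 $ 2 = e" "mat33 a b c d e f g h i $ 2 $ 3 = f"
  "mat33 a b c d e f g h i $ 3 $ 1 = g" "mat33 a b c d e f g h i $ 3 $ 2 = h"
  "mat33 a b c d e f g h i $ 3 $ 3 = i"
  by (simp_all add: mat33_def)

lemma mat22_nth [simp]:
  "mat22 a b c d $ 1 $ 1 = a" "mat22 a b c d $ 1 $ 2 = b"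
  "mat22 a b c d $ 2 $ 1 = c" "mat22 a b c d $ 2 $ 2 = d"
  by (simp_all add: mat22_def)

lemma mat33_eta: "mat33 (g$1$1) (g$1$2) (g$1$3) (g$2$1) (g$2$2) (g$2$3) (g$3$1) (g$3$2) (g$3$3) = g"
  by (simp add: vec_eq_iff forall_3)

lemma mat22_eta: "mat22 (g$1$1) (g$1$2) (g$2$1) (g$2$2) = g"
  by (simp add: vec_eq_iff forall_2)

lemma mat33_cases:
  obtains a b c d e f g' h i where "g = mat33 a b c d e f g' h i"
  using mat33_eta[of g] by metis

lemma mat22_cases:
  obtains a b c d where "g = mat22 a b c d"
  using mat22_eta[of g] by metis

lemma mat33_eq_iff [simp]:
  "mat33 a b c d e f g h i = mat33 a' b' c' d' e' f' g' h' i' \<longleftrightarrow>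
     a = a' \<and> b = b' \<and> c = c' \<and> d = d' \<and> e = e' \<and> f = f' \<and> g = g' \<and> h = h' \<and> i = i'"
  by (auto simp: vec_eq_iff forall_3)

lemma mat22_eq_iff [simp]:
  "mat22 a b c d = mat22 a' b' c' d' \<longleftrightarrow> a = a' \<and> b = b' \<and> c = c' \<and> d = d'"
  by (auto simp: vec_eq_iff forall_2)

lemma mat33_mult:
  fixes a :: "'a::semiring_1"
  shows "mat33 a b c d e f g h i ** mat33 a' b' c' d' e' f' g' h' i' =
    mat33 (a*a' + b*d' + c*g') (a*b' + b*e' + c*h') (a*c' + b*f' + c*i')
          (d*a' + e*d' + f*g') (d*b' + e*e' + f*h') (d*c' + e*f' + f*i')
          (g*a' + h*d' + i*g') (g*b' + h*e' + i*h') (g*c' + h*f' + i*i')"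
  by (simp add: vec_eq_iff forall_3 matrix_matrix_mult_def sum_3)

lemma mat22_mult:
  fixes a :: "'a::semiring_1"
  shows "mat22 a b c d ** mat22 a' b' c' d' =
    mat22 (a*a' + b*c') (a*b' + b*d') (c*a' + d*c') (c*b' + d*d')"
  by (simp add: vec_eq_iff forall_2 matrix_matrix_mult_def sum_2)

lemma mat_1_mat33: "mat 1 = mat33 1 0 0 0 1 0 0 0 1"
  by (simp add: vec_eq_iff forall_3 mat_def)

lemma mat_1_mat22: "mat 1 = mat22 1 0 0 1"
  by (simp add: vec_eq_iff forall_2 mat_def)

lemma det_mat33: "det (mat33 a b c d e f g h i) =
    a*e*i + b*f*g + c*d*h - a*f*h - b*d*i - c*e*g" for a :: "'a::comm_ring_1"
  by (simp add: det_3)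

lemma det_unit_if_invertible:
  fixes A :: "'a::comm_ring_1^'n^'n"
  assumes "invertible A"
  shows "det A dvd 1"
proof -
  obtain B where "A ** B = mat 1" using assms by (auto simp: invertible_def)
  then have "det A * det B = 1" by (metis det_mul det_I)
  then show ?thesis by (metis dvd_triv_left)
qed

lemma invertible_mat33_iff:
  "invertible (mat33 a b c d e f g h i) \<longleftrightarrow>
     a*e*i + b*f*g + c*d*h - a*f*h - b*d*i - c*e*g dvd 1" for a :: "'a::comm_ring_1"
proof
  show "invertible (mat33 a b c d e f g h i) \<Longrightarrow>
     a*e*i + b*f*g + c*d*h - a*f*h - b*d*i - c*e*g dvd 1"
    using det_unit_if_invertible[of "mat33 a b c d e f g h i"] by (simp add: det_mat33)
next
  assume "a*e*i + b*f*g + c*d*h - a*f*h - b*d*i - c*e*g dvd 1"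
  then obtain v where v: "(a*e*i + b*f*g + c*d*h - a*f*h - b*d*i - c*e*g) * v = 1"
    by (rule unitE)
  \<comment> \<open>The adjugate, scaled by the inverse \<open>v\<close> of the determinant.\<close>
  let ?B = "mat33 ((e*i - f*h) * v) ((c*h - b*i) * v) ((b*f - c*e) * v)
                  ((f*g - d*i) * v) ((a*i - c*g) * v) ((c*d - a*f) * v)
                  ((d*h - e*g) * v) ((b*g - a*h) * v) ((a*e - b*d) * v)"
  have "mat33 a b c d e f g h i ** ?B = mat 1" "?B ** mat33 a b c d e f g h i = mat 1"
    using v by (simp_all add: mat33_mult mat_1_mat33 algebra_simps)
  then show "invertible (mat33 a b c d e f g h i)" unfolding invertible_def by blast
qed

lemma invertible_mat22_iff:
  "invertible (mat22 a b c d) \<longleftrightarrow> a*d - b*c dvd 1" for a :: "'a::comm_ring_1"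
proof
  show "invertible (mat22 a b c d) \<Longrightarrow> a*d - b*c dvd 1"
    using det_unit_if_invertible[of "mat22 a b c d"] by (simp add: det_2)
next
  assume "a*d - b*c dvd 1"
  then obtain v where v: "(a*d - b*c) * v = 1" by (rule unitE)
  let ?B = "mat22 (d * v) (-b * v) (-c * v) (a * v)"
  have "mat22 a b c d ** ?B = mat 1" "?B ** mat22 a b c d = mat 1"
    using v by (simp_all add: mat22_mult mat_1_mat22 algebra_simps)
  then show "invertible (mat22 a b c d)" unfolding invertible_def by blast
qed

lemma mat33_in_borel3:
  "mat33 a b c d e f g h i \<in> borel3 \<longleftrightarrow> a dvd 1 \<and> e dvd 1 \<and> i dvd 1 \<and> d = 0 \<and> g = 0 \<and> h = 0"
proof (cases "d = 0 \<and> g = 0 \<and> h = 0")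
  case True
  then show ?thesis by (simp add: borel3_def invertible_mat33_iff units_mult)
next
  case False
  then show ?thesis unfolding borel3_def by simp blast
qed

lemma mat22_in_borel2:
  "mat22 a b c d \<in> borel2 \<longleftrightarrow> a dvd 1 \<and> d dvd 1 \<and> c = 0"
proof (cases "c = 0")
  case True
  then show ?thesis by (simp add: borel2_def invertible_mat22_iff units_mult)
next
  case False
  then show ?thesis by (simp add: borel2_def)
qed

lemma borel3E:
  assumes "X \<in> borel3"
  obtains a b c e f i where "X = mat33 a b c 0 e f 0 0 i" "a dvd 1" "e dvd 1" "i dvd 1"
proof -
  obtain a b c d e f g h i where "X = mat33 a b c d e f g h i" by (rule mat33_cases)
  with assms that show ?thesis by (auto simp: mat33_in_borel3)
qed

lemma borel2E:
  assumes "X \<in> borel2"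
  obtains a b d where "X = mat22 a b 0 d" "a dvd 1" "d dvd 1"
proof -
  obtain a b c d where "X = mat22 a b c d" by (rule mat22_cases)
  with assms that show ?thesis by (auto simp: mat22_in_borel2)
qed

lemma matrix_group_borel3: "matrix_group (borel3 :: ('a::comm_ring_1^3^3) set)"
  unfolding matrix_group_def
proof (intro conjI ballI)
  show "mat 1 \<in> borel3" by (simp add: mat_1_mat33 mat33_in_borel3)
  show "X ** Y \<in> borel3" if "X \<in> borel3" "Y \<in> borel3" for X Y :: "'a^3^3"
    using that by (elim borel3E) (simp add: mat33_mult mat33_in_borel3 units_mult)
  show "\<exists>Y\<in>borel3. X ** Y = mat 1 \<and> Y ** X = mat 1" if X: "X \<in> borel3" for X :: "'a^3^3"
  proof -
    obtain a b c e f i where X: "X = mat33 a b c 0 e f 0 0 i" "a dvd 1" "e dvd 1" "i dvd 1"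
      using X by (rule borel3E)
    obtain a' e' i' where inv: "a * a' = 1" "e * e' = 1" "i * i' = 1"
      and u: "a' dvd 1" "e' dvd 1" "i' dvd 1"
      using X(2-) by (metis unitE)
    have red: "a * (a' * x) = x" "e * (e' * x) = x" "i * (i' * x) = x"
      "a' * (a * x) = x" "e' * (e * x) = x" "i' * (i * x) = x" for x
      using inv by (simp_all add: mult.commute flip: mult.assoc)
    let ?Y = "mat33 a' (- (a' * b * e')) (a' * (b * e' * f - c) * i') 0 e' (- (e' * f * i')) 0 0 i'"
    have "X ** ?Y = mat 1" "?Y ** X = mat 1"
      using inv by (simp_all add: X mat33_mult mat_1_mat33 algebra_simps red)
    moreover have "?Y \<in> borel3" using u by (simp add: mat33_in_borel3)
    ultimately show ?thesis by blast
  qed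
qed

lemma matrix_group_borel2: "matrix_group (borel2 :: ('a::comm_ring_1^2^2) set)"
  unfolding matrix_group_def
proof (intro conjI ballI)
  show "mat 1 \<in> borel2" by (simp add: mat_1_mat22 mat22_in_borel2)
  show "X ** Y \<in> borel2" if "X \<in> borel2" "Y \<in> borel2" for X Y :: "'a^2^2"
    using that by (elim borel2E) (simp add: mat22_mult mat22_in_borel2 units_mult)
  show "\<exists>Y\<in>borel2. X ** Y = mat 1 \<and> Y ** X = mat 1" if X: "X \<in> borel2" for X :: "'a^2^2"
  proof -
    obtain a b d where X: "X = mat22 a b 0 d" "a dvd 1" "d dvd 1" using X by (rule borel2E)
    obtain a' d' where inv: "a * a' = 1" "d * d' = 1" and u: "a' dvd 1" "d' dvd 1"
      using X(2-) by (metis unitE)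
    have red: "a * (a' * x) = x" "d * (d' * x) = x"  "a' * (a * x) = x" "d' * (d * x) = x" for x
      using inv by (simp_all add: mult.commute flip: mult.assoc)
    let ?Y = "mat22 a' (- (a' * b * d')) 0 d'"
    have "X ** ?Y = mat 1" "?Y ** X = mat 1"
      using inv by (simp_all add: X mat22_mult mat_1_mat22 algebra_simps red)
    moreover have "?Y \<in> borel2" using u by (simp add: mat22_in_borel2)
    ultimately show ?thesis by blast
  qed
qed


section \<open>Normal forms in the double cosets of \<open>GL\<^sub>3\<close>\<close>

abbreviation dc3 :: "'a::comm_ring_1^3^3 \<Rightarrow> ('a^3^3) set" where
  "dc3 \<equiv> double_coset borel3"

lemma dc3_eqI:
  assumes "b \<in> borel3" "c \<in> borel3" "h = b ** g ** c"
  shows "dc3 g = dc3 h"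
  unfolding double_coset_eq_iff[OF matrix_group_borel3]
  using assms unfolding double_coset_def by blast

text \<open>One left multiplication bundles everything an upper triangular matrix can do to rows:
  scaling by units and adding multiples of lower rows to higher ones. Elimination in columns
  therefore runs upwards, and with \<open>column_operations\<close> elimination in rows runs to the
  right.\<close>

lemma row_operations:
  assumes "x1 dvd 1" "x2 dvd 1" "x3 dvd 1"
  shows "dc3 (mat33 a b c d e f g h i) =
    dc3 (mat33 (x1*a + y*d + z*g) (x1*b + y*e + z*h) (x1*c + y*f + z*i)
               (x2*d + t*g) (x2*e + t*h) (x2*f + t*i) (x3*g) (x3*h) (x3*i))"
proof (rule dc3_eqI)
  show "mat33 x1 y z 0 x2 t 0 0 x3 \<in> borel3" using assms by (simp add: mat33_in_borel3)
  show "mat 1 \<in> borel3" by (simp add: mat_1_mat33 mat33_in_borel3)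
qed (simp add: mat33_mult matrix_mul_rid)

lemma column_operations:
  assumes "p1 dvd 1" "p2 dvd 1" "p3 dvd 1"
  shows "dc3 (mat33 a b c d e f g h i) =
    dc3 (mat33 (p1*a) (p2*b + q*a) (p3*c + r*a + s*b)
               (p1*d) (p2*e + q*d) (p3*f + r*d + s*e)
               (p1*g) (p2*h + q*g) (p3*i + r*g + s*h))"
proof (rule dc3_eqI[of "mat 1" "mat33 p1 q r 0 p2 s 0 0 p3"])
  show "mat33 p1 q r 0 p2 s 0 0 p3 \<in> borel3" using assms by (simp add: mat33_in_borel3)
  show "mat 1 \<in> borel3" by (simp add: mat_1_mat33 mat33_in_borel3)
qed (simp add: mat33_mult matrix_mul_lid algebra_simps)

lemma dc3_invertible:
  fixes g h :: "'a::comm_ring_1^3^3"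
  assumes "dc3 g = dc3 h" "invertible g"
  shows "invertible h"
proof -
  have "h \<in> dc3 g" using assms(1) double_coset_eq_iff[OF matrix_group_borel3] by blast
  then obtain b c where "b \<in> borel3" "c \<in> borel3" "h = b ** g ** c" by (auto simp: double_coset_def)
  then show ?thesis using assms(2) by (auto simp: borel3_def intro!: invertible_mult)
qed

lemma eliminate:
  fixes u :: "'a::comm_ring_1"
  assumes "u dvd 1"
  shows "\<exists>q. x + q * u = 0"
proof -
  obtain v where "u * v = 1" using assms by (rule unitE)
  moreover have "x + (- (x * v)) * u = x - x * (u * v)" by (simp add: ac_simps)
  ultimately have "x + (- (x * v)) * u = 0" by simp
  then show ?thesis ..
qed

lemma rescale:
  fixes u :: "'a::comm_ring_1"
  assumes "u dvd 1"
  shows "\<exists>v. v * u = 1 \<and> v dvd 1"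
  using assms by (metis unitE mult.commute)

context uniformized_local_pir
begin

section \<open>Elimination in the six Bruhat cells\<close>

lemma pi_dvd_diff_iff:
  assumes "\<pi> dvd y"
  shows "\<pi> dvd x - y \<longleftrightarrow> \<pi> dvd x" "\<pi> dvd y - x \<longleftrightarrow> \<pi> dvd x"
  using dvd_add_left_iff[OF assms, of "x - y"] dvd_add_right_iff[OF assms, of "-x"] by simp_all

text \<open>Being a unit depends only on the residue modulo \<open>\<pi>\<close>. As a
  \<open>simp\<close> rule this recognises pivots as units after elimination has perturbed
  them.\<close>

lemma unit_perturb_iff [simp]:
  assumes "\<pi> dvd y"
  shows "x - y dvd 1 \<longleftrightarrow> x dvd 1" "y - x dvd 1 \<longleftrightarrow> x dvd 1"
    "x + y dvd 1 \<longleftrightarrow> x dvd 1" "y + x dvd 1 \<longleftrightarrow> x dvd 1"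
  using assms by (simp_all add: unit_iff dvd_add_left_iff dvd_add_right_iff pi_dvd_diff_iff)

text \<open>Common first step for the cells 5 and 6: the unit corner clears the bottom row to its
  right and then the first column above it.\<close>

lemma normal_form_bottom_left_pivot:
  assumes "g dvd 1"
  obtains b' c' e' f' where "dc3 (mat33 a b c d e f g h i) = dc3 (mat33 0 b' c' 0 e' f' 1 0 0)"
proof -
  obtain q r z t v where *: "h + q * g = 0" "i + r * g = 0" "a + z * g = 0" "d + t * g = 0"
    "v * g = 1" "v dvd 1"
    using eliminate[OF assms] rescale[OF assms] by metis
  have "dc3 (mat33 a b c d e f g h i) = dc3 (mat33 a (b+q*a) (c+r*a) d (e+q*d) (f+r*d) g 0 0)"
    using column_operations[of 1 1 1 a b c d e f g h i q r 0] * by simp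
  also have "\<dots> = dc3 (mat33 0 (b+q*a) (c+r*a) 0 (e+q*d) (f+r*d) 1 0 0)"
    using row_operations[of 1 1 v a "b+q*a" "c+r*a" d "e+q*d" "f+r*d" g 0 0 0 z t] * by simp
  finally show ?thesis by (rule that)
qed

text \<open>The normal forms are numbered like the permutations. Invertibility, carried along the
  double coset, makes the last pivot \<open>c + s * b\<close> a unit; the same device supplies
  missing pivots in \<open>normal_form4\<close>, \<open>normal_form3\<close> and
  \<open>normal_form2\<close>.\<close>

lemma normal_form6:
  assumes inv: "invertible (mat33 0 b c 0 e f 1 0 0)" and e: "e dvd 1"
  shows "dc3 (mat33 0 b c 0 e f 1 0 0) = dc3 (mat33 0 0 1 0 1 0 1 0 0)"
proof -
  obtain s where s: "f + s * e = 0" using eliminate[OF e] by blast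
  have *: "dc3 (mat33 0 b c 0 e f 1 0 0) = dc3 (mat33 0 b (c + s*b) 0 e 0 1 0 0)"
    using column_operations[of 1 1 1 0 b c 0 e f 1 0 0 0 0 s] s by simp
  have "c + s * b dvd 1"
    using dc3_invertible[OF * inv] by (simp add: invertible_mat33_iff units_mult)
  then obtain y v w where y: "b + y * e = 0" "v * (c + s*b) = 1" "v dvd 1" "w * e = 1" "w dvd 1"
    using eliminate[OF e] rescale[OF e] rescale[of "c + s * b"] by metis
  note *
  also have "dc3 (mat33 0 b (c + s*b) 0 e 0 1 0 0) = dc3 (mat33 0 0 (c + s*b) 0 e 0 1 0 0)"
    using row_operations[of 1 1 1 0 b "c+s*b" 0 e 0 1 0 0 y 0 0] y by simp
  also have "\<dots> = dc3 (mat33 0 0 1 0 1 0 1 0 0)"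
    using row_operations[of v w 1 0 0 "c+s*b" 0 e 0 1 0 0 0 0 0] y by simp
  finally show ?thesis .
qed

text \<open>The sign in \<open>- m\<close> is chosen so that the lower left minor
  \<open>d * h - e * g\<close> of the normal form is \<open>m\<close> itself.\<close>

lemma normal_form5:
  assumes inv: "invertible (mat33 0 b c 0 e f 1 0 0)" and e: "\<pi> dvd e"
  obtains m where "dc3 (mat33 0 b c 0 e f 1 0 0) = dc3 (mat33 0 1 0 0 (- m) 1 1 0 0)"
proof -
  have bf: "b dvd 1" "f dvd 1"
    using inv e by (simp_all add: invertible_mat33_iff units_mult)
  obtain y where y: "c + y * f = 0" using eliminate[OF bf(2)] by blast
  have b': "b + y * e dvd 1" using bf e by simp
  obtain v w where vw: "v * (b + y*e) = 1" "v dvd 1" "w * f = 1" "w dvd 1"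
    using rescale[OF b'] rescale[OF bf(2)] by metis
  have "dc3 (mat33 0 b c 0 e f 1 0 0) = dc3 (mat33 0 (b + y*e) 0 0 e f 1 0 0)"
    using row_operations[of 1 1 1 0 b c 0 e f 1 0 0 y 0 0] y by simp
  also have "\<dots> = dc3 (mat33 0 1 0 0 (- (- (w * e))) 1 1 0 0)"
    using row_operations[of v w 1 0 "b+y*e" 0 0 e f 1 0 0 0 0 0] vw by simp
  finally show ?thesis by (rule that)
qed

text \<open>Since \<open>g\<close> is a nonunit, the unit minor forces both \<open>d\<close> and
  \<open>h\<close> to be units. The entry \<open>g\<close> lies below the pivot \<open>d\<close> and
  to the left of the pivot \<open>h\<close>, where no admissible operation clears it, so it survives
  as the parameter \<open>c'\<close>.\<close>

lemma normal_form4: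
  assumes inv: "invertible (mat33 a b c d e f g h i)"
    and g: "\<pi> dvd g" and m: "d * h - e * g dvd 1"
  obtains c' where "dc3 (mat33 a b c d e f g h i) = dc3 (mat33 0 0 1 1 0 0 c' 1 0)"
proof -
  have d: "d dvd 1" "h dvd 1" using m g by (simp_all add: units_mult)
  obtain q r where qr: "e + q * d = 0" "f + r * d = 0" using eliminate[OF d(1)] by metis
  have h': "h + q * g dvd 1" using d g by simp
  obtain s z where sz: "(i + r*g) + s * (h + q*g) = 0" "(b + q*a) + z * (h + q*g) = 0"
    using eliminate[OF h'] by metis
  obtain y where y: "(a + z*g) + y * d = 0" using eliminate[OF d(1)] by metis
  obtain v w where vw: "v * d = 1" "v dvd 1" "w * (h + q*g) = 1" "w dvd 1"
    using rescale[OF d(1)] rescale[OF h'] by metis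
  let ?c = "c + r*a + s*(b + q*a)"
  have "dc3 (mat33 a b c d e f g h i) = dc3 (mat33 a (b+q*a) (c+r*a) d 0 0 g (h+q*g) (i+r*g))"
    using column_operations[of 1 1 1 a b c d e f g h i q r 0] qr by simp
  also have "\<dots> = dc3 (mat33 a (b+q*a) ?c d 0 0 g (h+q*g) 0)"
    using column_operations[of 1 1 1 a "b+q*a" "c+r*a" d 0 0 g "h+q*g" "i+r*g" 0 0 s] sz by simp
  also have "\<dots> = dc3 (mat33 (a+z*g) 0 ?c d 0 0 g (h+q*g) 0)"
    using row_operations[of 1 1 1 a "b+q*a" ?c d 0 0 g "h+q*g" 0 0 z 0] sz by simp
  also have "\<dots> = dc3 (mat33 0 0 ?c d 0 0 g (h+q*g) 0)"
    using row_operations[of 1 1 1 "a+z*g" 0 ?c d 0 0 g "h+q*g" 0 y 0 0] y by simp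
  finally have *: "dc3 (mat33 a b c d e f g h i) = dc3 (mat33 0 0 ?c d 0 0 g (h+q*g) 0)" .
  then have "?c dvd 1"
    using dc3_invertible[OF * inv] by (simp add: invertible_mat33_iff units_mult)
  then obtain x where x: "x * ?c = 1" "x dvd 1" using rescale by metis
  note *
  also have "dc3 (mat33 0 0 ?c d 0 0 g (h+q*g) 0) = dc3 (mat33 0 0 1 1 0 0 (w*g) 1 0)"
    using row_operations[of x v w 0 0 ?c d 0 0 g "h+q*g" 0 0 0 0] x vw by simp
  finally show ?thesis by (rule that)
qed

lemma normal_form3:
  assumes inv: "invertible (mat33 a b c d e f g h i)"
    and g: "\<pi> dvd g" and h: "h dvd 1" and d: "\<pi> dvd d"
  obtains c' m where "dc3 (mat33 a b c d e f g h i) = dc3 (mat33 1 0 0 m 0 1 c' 1 0)"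
proof -
  obtain s z t where st: "i + s * h = 0" "b + z * h = 0" "e + t * h = 0"
    using eliminate[OF h] by metis
  let ?a = "a + z*g" and ?c = "c + s*b" and ?d = "d + t*g" and ?f = "f + s*e"
  have "dc3 (mat33 a b c d e f g h i) = dc3 (mat33 a b ?c d e ?f g h 0)"
    using column_operations[of 1 1 1 a b c d e f g h i 0 0 s] st by simp
  also have "\<dots> = dc3 (mat33 ?a 0 ?c ?d 0 ?f g h 0)"
    using row_operations[of 1 1 1 a b ?c d e ?f g h 0 0 z t] st by simp
  finally have *: "dc3 (mat33 a b c d e f g h i) = dc3 (mat33 ?a 0 ?c ?d 0 ?f g h 0)" .
  have d': "\<pi> dvd ?d" using d g by simp
  \<comment> \<open>The determinant is now \<open>?c * ?d * h - ?a * ?f * h\<close> with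
    \<open>?d\<close> divisible by \<open>\<pi>\<close>, so the second product is a unit.\<close>
  have af: "?a dvd 1" "?f dvd 1"
    using dc3_invertible[OF * inv] d' h by (simp_all add: invertible_mat33_iff units_mult)
  obtain y where y: "?c + y * ?f = 0" using eliminate[OF af(2)] by metis
  have a': "?a + y * ?d dvd 1" using af d' by simp
  obtain u v w where uvw: "u * (?a + y * ?d) = 1" "u dvd 1" "v * ?f = 1" "v dvd 1" "w * h = 1" "w dvd 1"
    using rescale[OF a'] rescale[OF af(2)] rescale[OF h] by metis
  note *
  also have "dc3 (mat33 ?a 0 ?c ?d 0 ?f g h 0) = dc3 (mat33 (?a + y * ?d) 0 0 ?d 0 ?f g h 0)"
    using row_operations[of 1 1 1 ?a 0 ?c ?d 0 ?f g h 0 y 0 0] y by simp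
  also have "\<dots> = dc3 (mat33 1 0 0 (v * ?d) 0 1 (w * g) 1 0)"
    using row_operations[of u v w "?a + y * ?d" 0 0 ?d 0 ?f g h 0 0 0 0] uvw by simp
  finally show ?thesis by (rule that)
qed

lemma normal_form2:
  assumes inv: "invertible (mat33 a b c d e f g h i)"
    and g: "\<pi> dvd g" and h: "\<pi> dvd h" and d: "d dvd 1"
  obtains c' m where "dc3 (mat33 a b c d e f g h i) = dc3 (mat33 0 1 0 1 0 0 c' m 1)"
proof -
  obtain q r y where qr: "e + q * d = 0" "f + r * d = 0" "a + y * d = 0"
    using eliminate[OF d] by metis
  let ?b = "b + q*a" and ?c = "c + r*a" and ?h = "h + q*g" and ?i = "i + r*g"
  have "dc3 (mat33 a b c d e f g h i) = dc3 (mat33 a ?b ?c d 0 0 g ?h ?i)"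
    using column_operations[of 1 1 1 a b c d e f g h i q r 0] qr by simp
  also have "\<dots> = dc3 (mat33 0 ?b ?c d 0 0 g ?h ?i)"
    using row_operations[of 1 1 1 a ?b ?c d 0 0 g ?h ?i y 0 0] qr by simp
  finally have *: "dc3 (mat33 a b c d e f g h i) = dc3 (mat33 0 ?b ?c d 0 0 g ?h ?i)" .
  have h': "\<pi> dvd ?h" using g h by simp
  have bi: "?b dvd 1" "?i dvd 1"
    using dc3_invertible[OF * inv] h' d by (simp_all add: invertible_mat33_iff units_mult)
  obtain z where z: "?c + z * ?i = 0" using eliminate[OF bi(2)] by metis
  \<comment> \<open>Clearing the top right entry with the last row puts \<open>z * g\<close> back
    into the top left corner; the pivot \<open>d\<close> removes it again.\<close>
  obtain y' where y': "z * g + y' * d = 0" using eliminate[OF d] by metis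
  have b': "?b + z * ?h dvd 1" using bi h' by simp
  obtain u v w where uvw: "u * (?b + z * ?h) = 1" "u dvd 1" "v * d = 1" "v dvd 1" "w * ?i = 1" "w dvd 1"
    using rescale[OF b'] rescale[OF bi(2)] rescale[OF d] by metis
  note *
  also have "dc3 (mat33 0 ?b ?c d 0 0 g ?h ?i) = dc3 (mat33 (z * g) (?b + z * ?h) 0 d 0 0 g ?h ?i)"
    using row_operations[of 1 1 1 0 ?b ?c d 0 0 g ?h ?i 0 z 0] z by simp
  also have "\<dots> = dc3 (mat33 0 (?b + z * ?h) 0 d 0 0 g ?h ?i)"
    using row_operations[of 1 1 1 "z * g" "?b + z * ?h" 0 d 0 0 g ?h ?i y' 0 0] y' by simp
  also have "\<dots> = dc3 (mat33 0 1 0 1 0 0 (w * g) (w * ?h) 1)"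
    using row_operations[of u v w 0 "?b + z * ?h" 0 d 0 0 g ?h ?i 0 0 0] uvw by simp
  finally show ?thesis by (rule that)
qed

text \<open>All operations change only the first row and the last column, so the lower left block
  survives entry by entry.\<close>

lemma normal_form1:
  assumes inv: "invertible (mat33 a b c d e f g h i)"
    and g: "\<pi> dvd g" and h: "\<pi> dvd h" and d: "\<pi> dvd d"
  shows "dc3 (mat33 a b c d e f g h i) = dc3 (mat33 1 0 0 d e 0 g h 1)"
proof -
  have aei: "a dvd 1" "e dvd 1" "i dvd 1"
    using inv g h d by (simp_all add: invertible_mat33_iff units_mult)
  obtain s where s: "f + s * e = 0" using eliminate[OF aei(2)] by metis
  let ?c = "c + s * b" and ?i = "i + s * h"
  have i': "?i dvd 1" using aei h by simp
  obtain z where z: "?c + z * ?i = 0" using eliminate[OF i'] by metis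
  let ?a = "a + z * g" and ?b = "b + z * h"
  obtain y where y: "?b + y * e = 0" using eliminate[OF aei(2)] by metis
  have a': "?a + y * d dvd 1" using aei g d by simp
  obtain u v where uv: "u * (?a + y * d) = 1" "u dvd 1" "v * ?i = 1" "v dvd 1"
    using rescale[OF a'] rescale[OF i'] by metis
  have "dc3 (mat33 a b c d e f g h i) = dc3 (mat33 a b ?c d e 0 g h ?i)"
    using column_operations[of 1 1 1 a b c d e f g h i 0 0 s] s by simp
  also have "\<dots> = dc3 (mat33 ?a ?b 0 d e 0 g h ?i)"
    using row_operations[of 1 1 1 a b ?c d e 0 g h ?i 0 z 0] z by simp
  also have "\<dots> = dc3 (mat33 (?a + y * d) 0 0 d e 0 g h ?i)"
    using row_operations[of 1 1 1 ?a ?b 0 d e 0 g h ?i y 0 0] y by simp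
  also have "\<dots> = dc3 (mat33 1 0 0 d e 0 g h ?i)"
    using row_operations[of u 1 1 "?a + y * d" 0 0 d e 0 g h ?i 0 0 0] uv by simp
  also have "\<dots> = dc3 (mat33 1 0 0 d e 0 g h 1)"
    using column_operations[of 1 1 v 1 0 0 d e 0 g h ?i 0 0 0] uv by simp
  finally show ?thesis .
qed

section \<open>The complete invariant of a double coset\<close>

definition coset_index ::
  "'a^3^3 \<Rightarrow> ('a^2^2) set + (enat \<times> enat) + (enat \<times> enat) + enat + enat + unit" where
  "coset_index g =
    (let c = g$3$1; m = g$2$1 * g$3$2 - g$2$2 * g$3$1 in
     if c dvd 1 then
       if m dvd 1 then Inr (Inr (Inr (Inr (Inr ()))))
       else Inr (Inr (Inr (Inr (Inl (val P m)))))
     else if m dvd 1 then Inr (Inr (Inr (Inl (val P c))))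
     else if g$3$2 dvd 1 then Inr (Inr (Inl (val P c, val P m)))
     else if g$2$1 dvd 1 then Inr (Inl (val P c, val P m))
     else Inl (double_coset borel2 (lower_left g)))"

text \<open>The order of the tests in \<open>coset_index\<close> matters: the Borel action adds
  multiples of the corner \<open>g\<close> to \<open>h\<close> and \<open>d\<close>, so whether
  these two are units is invariant only once \<open>g\<close> is a nonunit.\<close>

lemma coset_index_invariant:
  assumes "X \<in> borel3" "Y \<in> borel3"
  shows "coset_index (X ** M ** Y) = coset_index M"
proof -
  obtain a b c d e f g h i where M: "M = mat33 a b c d e f g h i" by (rule mat33_cases)
  obtain x1 y1 y2 x2 y3 x3 where X: "X = mat33 x1 y1 y2 0 x2 y3 0 0 x3"
    and x: "x1 dvd 1" "x2 dvd 1" "x3 dvd 1" using assms(1) by (rule borel3E)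
  obtain p1 q1 q2 p2 q3 p3 where Y: "Y = mat33 p1 q1 q2 0 p2 q3 0 0 p3"
    and p: "p1 dvd 1" "p2 dvd 1" "p3 dvd 1" using assms(2) by (rule borel3E)
  let ?N = "X ** M ** Y"
  have c: "?N$3$1 = (x3 * p1) * g" by (simp add: X Y M mat33_mult ac_simps)
  \<comment> \<open>The lower left block is acted on by the lower right block of \<open>X\<close>
    and the upper left block of \<open>Y\<close> alone, so its determinant is multiplied by
    theirs.\<close>
  have m: "?N$2$1 * ?N$3$2 - ?N$2$2 * ?N$3$1 = (x2 * x3 * p1 * p2) * (d * h - e * g)"
    by (simp add: X Y M mat33_mult algebra_simps)
  have h: "?N$3$2 = x3 * (g * q1) + (x3 * p2) * h" by (simp add: X Y M mat33_mult algebra_simps)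
  have d: "?N$2$1 = (y3 * p1) * g + (x2 * p1) * d" by (simp add: X Y M mat33_mult algebra_simps)
  have u: "x3 * p1 dvd 1" "x2 * x3 * p1 * p2 dvd 1" using x p by (simp_all add: units_mult)
  have "lower_left ?N = mat22 x2 y3 0 x3 ** lower_left M ** mat22 p1 q1 0 p2"
    by (simp add: X Y M mat33_mult mat22_mult lower_left_def)
  then have ll: "double_coset borel2 (lower_left ?N) = double_coset borel2 (lower_left M)"
  proof -
    assume "lower_left ?N = mat22 x2 y3 0 x3 ** lower_left M ** mat22 p1 q1 0 p2"
    moreover have "mat22 x2 y3 0 x3 \<in> borel2" "mat22 p1 q1 0 p2 \<in> borel2"
      using x p by (simp_all add: mat22_in_borel2)
    ultimately have "lower_left ?N \<in> double_coset borel2 (lower_left M)"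
      unfolding double_coset_def by blast
    then show ?thesis using double_coset_eq_iff[OF matrix_group_borel2] by blast
  qed
  show ?thesis
  proof (cases "g dvd 1")
    case True
    then show ?thesis
      unfolding coset_index_def Let_def m unfolding c val_mult_unit[OF u(1)] val_mult_unit[OF u(2)]
      using u by (simp add: M units_mult)
  next
    case False
    then have "\<pi> dvd g" by (simp add: unit_iff)
    then have "?N$3$2 dvd 1 \<longleftrightarrow> h dvd 1" "?N$2$1 dvd 1 \<longleftrightarrow> d dvd 1"
      using x p by (simp_all add: h d units_mult)
    then show ?thesis
      unfolding coset_index_def Let_def ll m unfolding c val_mult_unit[OF u(1)] val_mult_unit[OF u(2)]
      using u by (simp add: M units_mult)
  qed
qed

lemma coset_index_mat33:
  "coset_index (mat33 a b c d e f g h i) =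
    (if g dvd 1 then
       if d * h - e * g dvd 1 then Inr (Inr (Inr (Inr (Inr ()))))
       else Inr (Inr (Inr (Inr (Inl (val P (d * h - e * g))))))
     else if d * h - e * g dvd 1 then Inr (Inr (Inr (Inl (val P g))))
     else if h dvd 1 then Inr (Inr (Inl (val P g, val P (d * h - e * g))))
     else if d dvd 1 then Inr (Inl (val P g, val P (d * h - e * g)))
     else Inl (double_coset borel2 (mat22 d e g h)))"
  by (simp add: coset_index_def lower_left_def Let_def)

lemma coset_index_cong:
  assumes "dc3 g = dc3 h"
  shows "coset_index g = coset_index h"
proof -
  have "h \<in> dc3 g" using assms double_coset_eq_iff[OF matrix_group_borel3] by blast
  then show ?thesis by (auto simp: double_coset_def coset_index_invariant)
qed

text \<open>In cases 2 to 5 the index is evaluated both on \<open>M\<close> and on the normal form.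
  Their agreement forces both into the same branch, and this is what shows that the parameters
  \<open>c\<close> and \<open>m\<close> are nonunits.\<close>

lemma normal_form_cases:
  assumes inv: "invertible M"
  obtains
    (1) d e g h where "dc3 M = dc3 (mat33 1 0 0 d e 0 g h 1)" "lower_left M = mat22 d e g h"
      "coset_index M = Inl (double_coset borel2 (mat22 d e g h))"
      "\<pi> dvd d" "e dvd 1" "\<pi> dvd g" "\<pi> dvd h"
  | (2) c m where "dc3 M = dc3 (mat33 0 1 0 1 0 0 c m 1)"
      "coset_index M = Inr (Inl (val P c, val P m))" "\<pi> dvd c" "\<pi> dvd m"
  | (3) c m where "dc3 M = dc3 (mat33 1 0 0 m 0 1 c 1 0)"
      "coset_index M = Inr (Inr (Inl (val P c, val P m)))" "\<pi> dvd c" "\<pi> dvd m"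
  | (4) c where "dc3 M = dc3 (mat33 0 0 1 1 0 0 c 1 0)"
      "coset_index M = Inr (Inr (Inr (Inl (val P c))))" "\<pi> dvd c"
  | (5) m where "dc3 M = dc3 (mat33 0 1 0 0 (- m) 1 1 0 0)"
      "coset_index M = Inr (Inr (Inr (Inr (Inl (val P m)))))" "\<pi> dvd m"
  | (6) "dc3 M = dc3 (mat33 0 0 1 0 1 0 1 0 0)"
      "coset_index M = Inr (Inr (Inr (Inr (Inr ()))))"
proof -
  obtain a b c d e f g h i where M: "M = mat33 a b c d e f g h i" by (rule mat33_cases)
  note inv = inv[unfolded M]
  show ?thesis
  proof (cases "g dvd 1")
    case True
    then obtain b' c' e' f' where *: "dc3 M = dc3 (mat33 0 b' c' 0 e' f' 1 0 0)"
      using normal_form_bottom_left_pivot M by metis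
    have inv': "invertible (mat33 0 b' c' 0 e' f' 1 0 0)"
      using dc3_invertible[OF *] assms by blast
    show ?thesis
    proof (cases "e' dvd 1")
      case True
      then show ?thesis
        using that(6) * normal_form6[OF inv' True] coset_index_cong[OF *]
        by (simp add: coset_index_mat33)
    next
      case False
      then obtain m where m: "dc3 (mat33 0 b' c' 0 e' f' 1 0 0) = dc3 (mat33 0 1 0 0 (- m) 1 1 0 0)"
        using normal_form5[OF inv'] by (auto simp: unit_iff)
      show ?thesis
        using that(5)[of m] * False m coset_index_cong[OF *] coset_index_cong[OF m]
        by (simp add: coset_index_mat33 unit_iff split: if_splits)
    qed
  next
    case g: False
    then have "\<pi> dvd g" by (simp add: unit_iff)
    show ?thesis
    proof (cases "d * h - e * g dvd 1")
      case True
      obtain c' where *: "dc3 M = dc3 (mat33 0 0 1 1 0 0 c' 1 0)"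
        using normal_form4[OF inv \<open>\<pi> dvd g\<close> True] M by metis
      show ?thesis
        using that(4)[of c'] * M g True coset_index_cong[OF *]
        by (simp add: coset_index_mat33 unit_iff split: if_splits)
    next
      case m: False
      have dh: "\<pi> dvd d \<or> \<pi> dvd h"
        using m \<open>\<pi> dvd g\<close> by (simp add: units_mult) (auto simp: unit_iff)
      consider "h dvd 1" | "\<pi> dvd h" "d dvd 1" | "\<pi> dvd h" "\<pi> dvd d"
        by (auto simp: unit_iff)
      then show ?thesis
      proof cases
        case 1
        then have "\<pi> dvd d" using dh by (simp add: unit_iff)
        obtain c' m' where *: "dc3 M = dc3 (mat33 1 0 0 m' 0 1 c' 1 0)"
          using normal_form3[OF inv \<open>\<pi> dvd g\<close> 1 \<open>\<pi> dvd d\<close>] M by metis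
        show ?thesis
          using that(3)[of m' c'] * M g m 1 coset_index_cong[OF *]
          by (simp add: coset_index_mat33 unit_iff split: if_splits)
      next
        case 2
        obtain c' m' where *: "dc3 M = dc3 (mat33 0 1 0 1 0 0 c' m' 1)"
          using normal_form2[OF inv \<open>\<pi> dvd g\<close> 2] M by metis
        show ?thesis
          using that(2)[of c' m'] * M g m 2 coset_index_cong[OF *]
          by (simp add: coset_index_mat33 unit_iff split: if_splits)
      next
        case 3
        have *: "dc3 M = dc3 (mat33 1 0 0 d e 0 g h 1)"
          using normal_form1[OF inv \<open>\<pi> dvd g\<close> 3] M by simp
        have "invertible (mat33 1 0 0 d e 0 g h 1)" using dc3_invertible[OF *] assms by blast
        then have "e dvd 1" by (simp add: invertible_mat33_iff)
        with that(1)[OF *] M g m 3 \<open>\<pi> dvd g\<close> show ?thesis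
          by (simp add: coset_index_mat33 unit_iff lower_left_def)
      qed
    qed
  qed
qed

text \<open>In cells 2 to 5 equal valuations make the parameters associates: one operation moves the
  unit factors into the parameters and a second restores the pivots disturbed by it.\<close>

lemma dc3_eq_if_coset_index_eq:
  assumes inv: "invertible M" "invertible N" and eq: "coset_index M = coset_index N"
  shows "dc3 M = dc3 N"
  using inv(1)
proof (cases rule: normal_form_cases)
  case M: (1 d e g h)
  from inv(2) obtain d' e' g' h' where N: "dc3 N = dc3 (mat33 1 0 0 d' e' 0 g' h' 1)"
    "double_coset borel2 (mat22 d e g h) = double_coset borel2 (mat22 d' e' g' h')"
    "\<pi> dvd d'" "\<pi> dvd g'" "\<pi> dvd h'"
    by (cases rule: normal_form_cases) (use eq M in auto)
  have "mat22 d' e' g' h' \<in> double_coset borel2 (mat22 d e g h)"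
    using N(2) by (simp only: double_coset_eq_iff[OF matrix_group_borel2])
  then obtain X Y where XY: "X \<in> borel2" "Y \<in> borel2" "mat22 d' e' g' h' = X ** mat22 d e g h ** Y"
    unfolding double_coset_def by blast
  obtain x y z where X: "X = mat22 x y 0 z" "x dvd 1" "z dvd 1" using XY(1) by (rule borel2E)
  obtain p q r where Y: "Y = mat22 p q 0 r" "p dvd 1" "r dvd 1" using XY(2) by (rule borel2E)
  \<comment> \<open>\<open>X\<close> is embedded as lower right block and \<open>Y\<close> as upper
    left block. This spoils only the first row and the last column, which
    \<open>normal_form1\<close> repairs.\<close>
  have *: "dc3 (mat33 1 0 0 d e 0 g h 1) = dc3 (mat33 p q 0 d' e' y g' h' z)"
  proof (rule dc3_eqI[of "mat33 1 0 0 0 x y 0 0 z" "mat33 p q 0 0 r 0 0 0 1"])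
    show "mat33 p q 0 d' e' y g' h' z =
      mat33 1 0 0 0 x y 0 0 z ** mat33 1 0 0 d e 0 g h 1 ** mat33 p q 0 0 r 0 0 0 1"
      using XY(3) by (simp add: X Y mat22_mult mat33_mult)
  qed (use X Y in \<open>simp_all add: mat33_in_borel3\<close>)
  then have "invertible (mat33 p q 0 d' e' y g' h' z)"
    using dc3_invertible M(1) inv(1) by metis
  then show ?thesis using normal_form1 N M(1) * by metis
next
  case M: (2 c m)
  from inv(2) obtain c' m' where N: "dc3 N = dc3 (mat33 0 1 0 1 0 0 c' m' 1)"
    "val P c = val P c'" "val P m = val P m'"
    by (cases rule: normal_form_cases) (use eq M in auto)
  obtain s t where st: "s dvd 1" "c' = s * c" "t dvd 1" "m' = t * m"
    using N val_eqE by metis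
  obtain s' t' where st': "s' * s = 1" "s' dvd 1" "t' * t = 1" "t' dvd 1"
    using rescale st by metis
  have "dc3 M = dc3 (mat33 0 t 0 s 0 0 c' m' 1)"
    using M column_operations[of s t 1 0 1 0 1 0 0 c m 1 0 0 0] st by simp
  also have "\<dots> = dc3 (mat33 0 1 0 1 0 0 c' m' 1)"
    using row_operations[of t' s' 1 0 t 0 s 0 0 c' m' 1 0 0 0] st' by simp
  finally show ?thesis using N by simp
next
  case M: (3 c m)
  from inv(2) obtain c' m' where N: "dc3 N = dc3 (mat33 1 0 0 m' 0 1 c' 1 0)"
    "val P c = val P c'" "val P m = val P m'"
    by (cases rule: normal_form_cases) (use eq M in auto)
  obtain s t where st: "s dvd 1" "c' = s * c" "t dvd 1" "m' = t * m"
    using N val_eqE by metis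
  obtain s' t' where st': "s' * s = 1" "s' dvd 1" "t' * t = 1" "t' dvd 1"
    using rescale st by metis
  have "dc3 M = dc3 (mat33 1 0 0 m' 0 t c' s 0)"
    using M row_operations[of 1 t s 1 0 0 m 0 1 c 1 0 0 0 0] st by simp
  also have "\<dots> = dc3 (mat33 1 0 0 m' 0 1 c' 1 0)"
    using column_operations[of 1 s' t' 1 0 0 m' 0 t c' s 0 0 0 0] st' by simp
  finally show ?thesis using N by simp
next
  case M: (4 c)
  from inv(2) obtain c' where N: "dc3 N = dc3 (mat33 0 0 1 1 0 0 c' 1 0)" "val P c = val P c'"
    by (cases rule: normal_form_cases) (use eq M in auto)
  obtain s where s: "s dvd 1" "c' = s * c" using N val_eqE by metis
  obtain s' where s': "s' * s = 1" "s' dvd 1" using rescale s by metis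
  have "dc3 M = dc3 (mat33 0 0 1 s 0 0 c' 1 0)"
    using M column_operations[of s 1 1 0 0 1 1 0 0 c 1 0 0 0 0] s by simp
  also have "\<dots> = dc3 (mat33 0 0 1 1 0 0 c' 1 0)"
    using row_operations[of 1 s' 1 0 0 1 s 0 0 c' 1 0 0 0 0] s' by simp
  finally show ?thesis using N by simp
next
  case M: (5 m)
  from inv(2) obtain m' where N: "dc3 N = dc3 (mat33 0 1 0 0 (- m') 1 1 0 0)" "val P m = val P m'"
    by (cases rule: normal_form_cases) (use eq M in auto)
  obtain s where s: "s dvd 1" "m' = s * m" using N val_eqE by metis
  obtain s' where s': "s' * s = 1" "s' dvd 1" using rescale s by metis
  have "dc3 M = dc3 (mat33 0 s 0 0 (- m') 1 1 0 0)"
    using M column_operations[of 1 s 1 0 1 0 0 "- m" 1 1 0 0 0 0 0] s by simp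
  also have "\<dots> = dc3 (mat33 0 1 0 0 (- m') 1 1 0 0)"
    using row_operations[of s' 1 1 0 s 0 0 "- m'" 1 1 0 0 0 0 0] s' by simp
  finally show ?thesis using N by simp
next
  case M: 6
  from inv(2) have "dc3 N = dc3 (mat33 0 0 1 0 1 0 1 0 0)"
    by (cases rule: normal_form_cases) (use eq M in auto)
  then show ?thesis using M by simp
qed


subsection \<open>Bruhat cells\<close>

lemma unit_cong:
  assumes "\<pi> dvd x - y"
  shows "x dvd 1 \<longleftrightarrow> y dvd 1"
  using unit_perturb_iff(3)[OF assms, of y] by simp

lemma mat_cong_iff: "mat_cong P X Y \<longleftrightarrow> (\<forall>i j. \<pi> dvd X$i$j - Y$i$j)"
  by (simp add: mat_cong_def P_iff_dvd)

lemma mat_cong_mult: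
  fixes A B X Y :: "'a^'n^'n"
  assumes "mat_cong P X Y"
  shows "mat_cong P (A ** X ** B) (A ** Y ** B)"
proof -
  have left: "mat_cong P (A ** X) (A ** Y)" if "mat_cong P X Y" for A X Y :: "'a^'n^'n"
    using that unfolding mat_cong_iff matrix_matrix_mult_def
    by (auto simp: sum_subtractf[symmetric] right_diff_distrib[symmetric] intro!: dvd_sum dvd_mult)
  have right: "mat_cong P (X ** B) (Y ** B)" if "mat_cong P X Y" for B X Y :: "'a^'n^'n"
    using that unfolding mat_cong_iff matrix_matrix_mult_def
    by (auto simp: sum_subtractf[symmetric] left_diff_distrib[symmetric] intro!: dvd_sum dvd_mult2)
  show ?thesis by (intro left right assms)
qed

text \<open>One diagonal congruence each shows that \<open>a\<close> and \<open>i\<close> are units.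
  The middle congruence also involves \<open>f * h'\<close>, so \<open>h'\<close> must first be
  placed in \<open>P\<close>; position (3,2) of \<open>X ** Y\<close> does this because
  \<open>i\<close> is a unit.\<close>

lemma borel3_modE:
  assumes "X \<in> borel3_mod P"
  obtains a b c d e f g h i where "X = mat33 a b c d e f g h i"
    "a dvd 1" "e dvd 1" "i dvd 1" "\<pi> dvd d" "\<pi> dvd g" "\<pi> dvd h"
proof -
  obtain a b c d e f g h i where X: "X = mat33 a b c d e f g h i" by (rule mat33_cases)
  obtain Y where Y: "mat_cong P (X ** Y) (mat 1)" "mat_cong P (Y ** X) (mat 1)"
    and low: "\<pi> dvd d" "\<pi> dvd g" "\<pi> dvd h"
    using assms by (auto simp: borel3_mod_def X P_iff_dvd)
  obtain a' b' c' d' e' f' g' h' i' where Y': "Y = mat33 a' b' c' d' e' f' g' h' i'"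
    by (rule mat33_cases)
  note cong = Y[unfolded mat_cong_iff forall_3 X Y' mat33_mult mat_1_mat33, simplified]
  have "a' * a + b' * d + c' * g dvd 1" "g * c' + h * f' + i * i' dvd 1"
    "d * b' + e * e' + f * h' dvd 1" "\<pi> dvd g * b' + h * e' + i * h'"
    using cong by (auto simp: unit_cong)
  then have "a dvd 1" "i dvd 1" "d * b' + e * e' + f * h' dvd 1" "\<pi> dvd i * h'"
    using low by (simp_all add: units_mult dvd_add_right_iff)
  moreover from this have "\<pi> dvd h'" by (simp add: nonunit_mult unit_iff)
  ultimately have "e dvd 1" using low by (simp add: units_mult)
  with \<open>a dvd 1\<close> \<open>i dvd 1\<close> low X that show ?thesis by blast
qed

lemma borel3_modI:
  assumes "invertible X" "\<pi> dvd X$2$1" "\<pi> dvd X$3$1" "\<pi> dvd X$3$2"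
  shows "X \<in> borel3_mod P"
proof -
  obtain Y where "X ** Y = mat 1" "Y ** X = mat 1" using assms(1) by (auto simp: invertible_def)
  moreover have "mat_cong P (mat 1) (mat 1 :: 'a^3^3)" by (simp add: mat_cong_iff)
  ultimately have "mat_cong P (X ** Y) (mat 1) \<and> mat_cong P (Y ** X) (mat 1)" by simp
  then show ?thesis using assms(2-) unfolding borel3_mod_def P_iff_dvd by blast
qed

lemma borel3_subset_mod: "borel3 \<subseteq> borel3_mod P"
  by (auto simp: borel3_def intro!: borel3_modI)

lemma bruhat_cellI:
  assumes "invertible M" "dc3 M = dc3 N" "mat_cong P N w"
  shows "M \<in> bruhat_cell P w"
proof -
  have "M \<in> dc3 N" using assms(2) mem_double_coset_self[OF matrix_group_borel3] by blast
  then obtain X Y where XY: "X \<in> borel3" "Y \<in> borel3" "M = X ** N ** Y"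
    by (auto simp: double_coset_def)
  moreover have "mat_cong P M (X ** w ** Y)" using mat_cong_mult[OF assms(3)] XY by simp
  ultimately show ?thesis
    using assms(1) borel3_subset_mod unfolding bruhat_cell_def by blast
qed

text \<open>Modulo \<open>P\<close> the left factor \<open>X\<close> scales the bottom row and the
  lower left minor by units, so the tests made by \<open>coset_index\<close> can be read off
  \<open>w ** Y\<close>. To the second row it also adds a multiple of the third, whence the
  condition on \<open>g\<close> in the statement about \<open>d\<close>.\<close>

lemma bruhat_cellE:
  assumes "mat33 a b c d e f g h i \<in> bruhat_cell P w"
  obtains Y where "Y \<in> borel3_mod P"
    "g dvd 1 \<longleftrightarrow> (w ** Y)$3$1 dvd 1"
    "h dvd 1 \<longleftrightarrow> (w ** Y)$3$2 dvd 1"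
    "\<not> g dvd 1 \<longrightarrow> (d dvd 1 \<longleftrightarrow> (w ** Y)$2$1 dvd 1)"
    "d * h - e * g dvd 1 \<longleftrightarrow>
      (w ** Y)$2$1 * (w ** Y)$3$2 - (w ** Y)$2$2 * (w ** Y)$3$1 dvd 1"
proof -
  obtain X Y where XY: "X \<in> borel3_mod P" "Y \<in> borel3_mod P"
    and cong: "mat_cong P (mat33 a b c d e f g h i) (X ** w ** Y)"
    using assms by (auto simp: bruhat_cell_def)
  obtain x1 y1 y2 d1 x2 y3 d2 d3 x3 where X: "X = mat33 x1 y1 y2 d1 x2 y3 d2 d3 x3"
    and u: "x1 dvd 1" "x2 dvd 1" "x3 dvd 1" and low: "\<pi> dvd d1" "\<pi> dvd d2" "\<pi> dvd d3"
    using XY(1) by (rule borel3_modE)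
  obtain z11 z12 z13 z21 z22 z23 z31 z32 z33 where
    Z: "w ** Y = mat33 z11 z12 z13 z21 z22 z23 z31 z32 z33" by (rule mat33_cases)
  have "X ** w ** Y = X ** mat33 z11 z12 z13 z21 z22 z23 z31 z32 z33"
    by (simp flip: Z add: matrix_mul_assoc)
  note cong = cong[unfolded this, unfolded X mat33_mult mat_cong_iff forall_3 mat33_nth]
  have dvd: "\<pi> dvd x - z" if "\<pi> dvd x - (p + q + z)" "\<pi> dvd p" "\<pi> dvd q" for x p q z
    using dvd_add[OF that(1) dvd_add[OF that(2,3)]] by (simp add: algebra_simps)
  have dvd': "\<pi> dvd x - (q + z)" if "\<pi> dvd x - (p + q + z)" "\<pi> dvd p" for x p q z
    using dvd_add[OF that(1,2)] by (simp add: algebra_simps)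
  have g: "\<pi> dvd g - x3 * z31" by (rule dvd[of g "d2 * z11" "d3 * z21"]) (use cong low in simp_all)
  have h: "\<pi> dvd h - x3 * z32" by (rule dvd[of h "d2 * z12" "d3 * z22"]) (use cong low in simp_all)
  have d: "\<pi> dvd d - (x2 * z21 + y3 * z31)" by (rule dvd'[of d "d1 * z11"]) (use cong low in simp_all)
  have e: "\<pi> dvd e - (x2 * z22 + y3 * z32)" by (rule dvd'[of e "d1 * z12"]) (use cong low in simp_all)
  have mult: "\<pi> dvd p * q - p' * q'" if "\<pi> dvd p - p'" "\<pi> dvd q - q'" for p q p' q'
  proof -
    have "p * q - p' * q' = (p - p') * q + p' * (q - q')" by (simp add: algebra_simps)
    then show ?thesis using that by simp
  qed
  have "\<pi> dvd (d * h - e * g) -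
      ((x2 * z21 + y3 * z31) * (x3 * z32) - (x2 * z22 + y3 * z32) * (x3 * z31))"
    using dvd_diff[OF mult[OF d h] mult[OF e g]] by (simp add: algebra_simps)
  moreover have "(x2 * z21 + y3 * z31) * (x3 * z32) - (x2 * z22 + y3 * z32) * (x3 * z31) =
      x2 * x3 * (z21 * z32 - z22 * z31)"
    by (simp add: algebra_simps)
  ultimately have "d * h - e * g dvd 1 \<longleftrightarrow> x2 * x3 * (z21 * z32 - z22 * z31) dvd 1"
    using unit_cong by metis
  then have m: "d * h - e * g dvd 1 \<longleftrightarrow> z21 * z32 - z22 * z31 dvd 1"
    using u by (simp add: units_mult)
  have g': "g dvd 1 \<longleftrightarrow> z31 dvd 1" and h': "h dvd 1 \<longleftrightarrow> z32 dvd 1"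
    using unit_cong[OF g] unit_cong[OF h] u by (simp_all add: units_mult)
  have d': "d dvd 1 \<longleftrightarrow> z21 dvd 1" if "\<not> g dvd 1"
  proof -
    have "\<pi> dvd z31" using that g' by (simp add: unit_iff)
    then show ?thesis using unit_cong[OF d] u by (simp add: units_mult)
  qed
  show ?thesis by (rule that[OF XY(2)]) (use g' h' d' m in \<open>simp_all add: Z\<close>)
qed

lemmas perm_defs = perm1_def perm2_def perm3_def perm4_def perm5_def perm6_def

text \<open>Modulo \<open>P\<close> the matrix \<open>Y\<close> is upper triangular with unit
  diagonal, so the outcome of every relevant test on \<open>w ** Y\<close> is fixed by the
  permutation \<open>w\<close>.\<close>

lemma coset_index_of_bruhat_cell:
  shows "M \<in> bruhat_cell P perm1 \<Longrightarrow> coset_index M \<in> range Inl"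
    and "M \<in> bruhat_cell P perm2 \<Longrightarrow> coset_index M \<in> range (Inr \<circ> Inl)"
    and "M \<in> bruhat_cell P perm3 \<Longrightarrow> coset_index M \<in> range (Inr \<circ> Inr \<circ> Inl)"
    and "M \<in> bruhat_cell P perm4 \<Longrightarrow> coset_index M \<in> range (Inr \<circ> Inr \<circ> Inr \<circ> Inl)"
    and "M \<in> bruhat_cell P perm5 \<Longrightarrow> coset_index M \<in> range (Inr \<circ> Inr \<circ> Inr \<circ> Inr \<circ> Inl)"
    and "M \<in> bruhat_cell P perm6 \<Longrightarrow> coset_index M \<in> range (Inr \<circ> Inr \<circ> Inr \<circ> Inr \<circ> Inr)"
proof -
  obtain a b c d e f g h i where M: "M = mat33 a b c d e f g h i" by (rule mat33_cases)
  have cell: thesis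
    if w: "M \<in> bruhat_cell P w"
      and goal: "\<And>y11 y12 y13 y21 y22 y23 y31 y32 y33 Z.
        Z = w ** mat33 y11 y12 y13 y21 y22 y23 y31 y32 y33 \<Longrightarrow> y11 dvd 1 \<Longrightarrow> y22 dvd 1 \<Longrightarrow> y33 dvd 1 \<Longrightarrow>
        \<pi> dvd y21 \<Longrightarrow> \<pi> dvd y31 \<Longrightarrow> \<pi> dvd y32 \<Longrightarrow>
        g dvd 1 \<longleftrightarrow> Z$3$1 dvd 1 \<Longrightarrow> h dvd 1 \<longleftrightarrow> Z$3$2 dvd 1 \<Longrightarrow>
        \<not> g dvd 1 \<longrightarrow> (d dvd 1 \<longleftrightarrow> Z$2$1 dvd 1) \<Longrightarrow>
        d * h - e * g dvd 1 \<longleftrightarrow> Z$2$1 * Z$3$2 - Z$2$2 * Z$3$1 dvd 1 \<Longrightarrow> thesis"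
    for w thesis
  proof -
    obtain Y where Y: "Y \<in> borel3_mod P"
      "g dvd 1 \<longleftrightarrow> (w ** Y)$3$1 dvd 1"
      "h dvd 1 \<longleftrightarrow> (w ** Y)$3$2 dvd 1"
      "\<not> g dvd 1 \<longrightarrow> (d dvd 1 \<longleftrightarrow> (w ** Y)$2$1 dvd 1)"
      "d * h - e * g dvd 1 \<longleftrightarrow>
        (w ** Y)$2$1 * (w ** Y)$3$2 - (w ** Y)$2$2 * (w ** Y)$3$1 dvd 1"
      using w[unfolded M] by (rule bruhat_cellE)
    obtain y11 y12 y13 y21 y22 y23 y31 y32 y33
      where y: "Y = mat33 y11 y12 y13 y21 y22 y23 y31 y32 y33"
      "y11 dvd 1" "y22 dvd 1" "y33 dvd 1" "\<pi> dvd y21" "\<pi> dvd y31" "\<pi> dvd y32"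
      using Y(1) by (rule borel3_modE)
    show thesis by (rule goal[OF _ y(2-) Y(2-)]) (simp_all add: y(1))
  qed
  have nonunit: "\<not> x dvd 1" if "\<pi> dvd x" for x using that by (simp add: unit_iff)
  show "coset_index M \<in> range Inl" if "M \<in> bruhat_cell P perm1"
    using that by (rule cell) (auto simp: perm_defs M mat33_mult coset_index_mat33 units_mult nonunit)
  show "coset_index M \<in> range (Inr \<circ> Inl)" if "M \<in> bruhat_cell P perm2"
    using that by (rule cell) (auto simp: perm_defs M mat33_mult coset_index_mat33 units_mult nonunit)
  show "coset_index M \<in> range (Inr \<circ> Inr \<circ> Inl)" if "M \<in> bruhat_cell P perm3"
    using that by (rule cell) (auto simp: perm_defs M mat33_mult coset_index_mat33 units_mult nonunit)
  show "coset_index M \<in> range (Inr \<circ> Inr \<circ> Inr \<circ> Inl)" if "M \<in> bruhat_cell P perm4"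
    using that by (rule cell) (auto simp: perm_defs M mat33_mult coset_index_mat33 units_mult nonunit)
  show "coset_index M \<in> range (Inr \<circ> Inr \<circ> Inr \<circ> Inr \<circ> Inl)" if "M \<in> bruhat_cell P perm5"
    using that by (rule cell) (auto simp: perm_defs M mat33_mult coset_index_mat33 units_mult nonunit)
  show "coset_index M \<in> range (Inr \<circ> Inr \<circ> Inr \<circ> Inr \<circ> Inr)" if "M \<in> bruhat_cell P perm6"
    using that by (rule cell) (auto simp: perm_defs M mat33_mult coset_index_mat33 units_mult nonunit)
qed

text \<open>One inclusion is \<open>coset_index_of_bruhat_cell\<close>. For the other, the normal
  forms 2 to 6 are congruent to their permutation matrices modulo \<open>P\<close>.\<close>

lemma bruhat_cell_iff:
  shows "bruhat_cell P perm1 = {M. invertible M \<and> coset_index M \<in> range Inl}"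
    and "bruhat_cell P perm2 = {M. invertible M \<and> coset_index M \<in> range (Inr \<circ> Inl)}"
    and "bruhat_cell P perm3 = {M. invertible M \<and> coset_index M \<in> range (Inr \<circ> Inr \<circ> Inl)}"
    and "bruhat_cell P perm4 = {M. invertible M \<and> coset_index M \<in> range (Inr \<circ> Inr \<circ> Inr \<circ> Inl)}"
    and "bruhat_cell P perm5 = {M. invertible M \<and> coset_index M \<in> range (Inr \<circ> Inr \<circ> Inr \<circ> Inr \<circ> Inl)}"
    and "bruhat_cell P perm6 = {M. invertible M \<and> coset_index M \<in> range (Inr \<circ> Inr \<circ> Inr \<circ> Inr \<circ> Inr)}"
proof -
  have inv: "invertible M" if "M \<in> bruhat_cell P w" for M w using that by (simp add: bruhat_cell_def)
  have cong: "mat_cong P (mat33 a b c d e f g h i) (mat33 a' b' c' d' e' f' g' h' i') \<longleftrightarrow>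
    \<pi> dvd a - a' \<and> \<pi> dvd b - b' \<and> \<pi> dvd c - c' \<and> \<pi> dvd d - d' \<and> \<pi> dvd e - e' \<and>
    \<pi> dvd f - f' \<and> \<pi> dvd g - g' \<and> \<pi> dvd h - h' \<and> \<pi> dvd i - i'"
    for a b c d e f g h i a' b' c' d' e' f' g' h' i'
    by (simp add: mat_cong_iff forall_3)
  \<comment> \<open>The normal form of this cell is not congruent to the identity, its middle entry
    being only a unit. Instead \<open>M\<close> itself is upper triangular modulo \<open>P\<close>
    and serves as the left factor.\<close>
  have 1: "M \<in> bruhat_cell P perm1" if inv: "invertible M" and idx: "coset_index M \<in> range Inl" for M
  proof -
    obtain a b c d e f g h i where M: "M = mat33 a b c d e f g h i" by (rule mat33_cases)
    have "\<pi> dvd d" "\<pi> dvd g" "\<pi> dvd h"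
      using idx by (auto simp: M coset_index_mat33 unit_iff split: if_splits)
    then have "M \<in> borel3_mod P" using inv by (intro borel3_modI) (simp_all add: M)
    moreover have "mat 1 \<in> borel3_mod P"
      using borel3_subset_mod matrix_group_borel3 by (auto simp: matrix_group_def)
    moreover have "mat_cong P M (M ** perm1 ** mat 1)"
      by (simp add: M perm1_def mat_1_mat33 mat33_mult cong)
    ultimately show ?thesis using inv unfolding bruhat_cell_def by blast
  qed
  have 2: "M \<in> bruhat_cell P perm2" if M: "invertible M" "coset_index M \<in> range (Inr \<circ> Inl)" for M
  proof -
    obtain c m where "dc3 M = dc3 (mat33 0 1 0 1 0 0 c m 1)" "\<pi> dvd c" "\<pi> dvd m"
      using M(1) by (cases rule: normal_form_cases) (use M(2) in auto)
    then show ?thesis using bruhat_cellI[OF M(1)] by (simp add: perm2_def cong)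
  qed
  have 3: "M \<in> bruhat_cell P perm3" if M: "invertible M" "coset_index M \<in> range (Inr \<circ> Inr \<circ> Inl)" for M
  proof -
    obtain c m where "dc3 M = dc3 (mat33 1 0 0 m 0 1 c 1 0)" "\<pi> dvd c" "\<pi> dvd m"
      using M(1) by (cases rule: normal_form_cases) (use M(2) in auto)
    then show ?thesis using bruhat_cellI[OF M(1)] by (simp add: perm3_def cong)
  qed
  have 4: "M \<in> bruhat_cell P perm4"
    if M: "invertible M" "coset_index M \<in> range (Inr \<circ> Inr \<circ> Inr \<circ> Inl)" for M
  proof -
    obtain c where "dc3 M = dc3 (mat33 0 0 1 1 0 0 c 1 0)" "\<pi> dvd c"
      using M(1) by (cases rule: normal_form_cases) (use M(2) in auto)
    then show ?thesis using bruhat_cellI[OF M(1)] by (simp add: perm4_def cong)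
  qed
  have 5: "M \<in> bruhat_cell P perm5"
    if M: "invertible M" "coset_index M \<in> range (Inr \<circ> Inr \<circ> Inr \<circ> Inr \<circ> Inl)" for M
  proof -
    obtain m where "dc3 M = dc3 (mat33 0 1 0 0 (- m) 1 1 0 0)" "\<pi> dvd m"
      using M(1) by (cases rule: normal_form_cases) (use M(2) in auto)
    then show ?thesis using bruhat_cellI[OF M(1)] by (simp add: perm5_def cong)
  qed
  have 6: "M \<in> bruhat_cell P perm6"
    if M: "invertible M" "coset_index M \<in> range (Inr \<circ> Inr \<circ> Inr \<circ> Inr \<circ> Inr)" for M
  proof -
    have "dc3 M = dc3 (mat33 0 0 1 0 1 0 1 0 0)"
      using M(1) by (cases rule: normal_form_cases) (use M(2) in auto)
    then show ?thesis using bruhat_cellI[OF M(1)] by (simp add: perm6_def cong)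
  qed
  note of_cell = coset_index_of_bruhat_cell
  show "bruhat_cell P perm1 = {M. invertible M \<and> coset_index M \<in> range Inl}"
    using 1 inv of_cell(1) by blast
  show "bruhat_cell P perm2 = {M. invertible M \<and> coset_index M \<in> range (Inr \<circ> Inl)}"
    using 2 inv of_cell(2) by blast
  show "bruhat_cell P perm3 = {M. invertible M \<and> coset_index M \<in> range (Inr \<circ> Inr \<circ> Inl)}"
    using 3 inv of_cell(3) by blast
  show "bruhat_cell P perm4 = {M. invertible M \<and> coset_index M \<in> range (Inr \<circ> Inr \<circ> Inr \<circ> Inl)}"
    using 4 inv of_cell(4) by blast
  show "bruhat_cell P perm5 =
      {M. invertible M \<and> coset_index M \<in> range (Inr \<circ> Inr \<circ> Inr \<circ> Inr \<circ> Inl)}"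
    using 5 inv of_cell(5) by blast
  show "bruhat_cell P perm6 =
      {M. invertible M \<and> coset_index M \<in> range (Inr \<circ> Inr \<circ> Inr \<circ> Inr \<circ> Inr)}"
    using 6 inv of_cell(6) by blast
qed

section \<open>The parametrisation of the double cosets of \<open>GL3\<close>\<close>

lemma coset_index_image:
  "coset_index ` {M. invertible M} =
    M2_orbits <+> (val P ` P \<times> val P ` P) <+> (val P ` P \<times> val P ` P) <+>
      val P ` P <+> val P ` P <+> {()}" (is "?L = ?R")
proof (intro subset_antisym subsetI)
  fix x assume "x \<in> ?L"
  then obtain M where M: "invertible M" "x = coset_index M" by blast
  from M(1) show "x \<in> ?R"
  proof (cases rule: normal_form_cases)
    case (1 d e g h)
    then have "mat22 d e g h \<in> M2_bullet" by (simp add: M2_bullet_def unit_iff)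
    with 1 M show ?thesis by (auto simp: M2_orbits_def)
  qed (use M in \<open>auto simp: P_iff_dvd\<close>)
next
  fix x assume "x \<in> ?R"
  then consider (1) \<alpha> where "\<alpha> \<in> M2_bullet" "x = Inl (double_coset borel2 \<alpha>)"
    | (2) c m where "\<pi> dvd c" "\<pi> dvd m" "x = Inr (Inl (val P c, val P m))"
    | (3) c m where "\<pi> dvd c" "\<pi> dvd m" "x = Inr (Inr (Inl (val P c, val P m)))"
    | (4) c where "\<pi> dvd c" "x = Inr (Inr (Inr (Inl (val P c))))"
    | (5) m where "\<pi> dvd m" "x = Inr (Inr (Inr (Inr (Inl (val P m)))))"
    | (6) "x = Inr (Inr (Inr (Inr (Inr ()))))"
    by (auto simp: M2_orbits_def P_iff_dvd)
  then show "x \<in> ?L"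
  proof cases
    case 1
    obtain d e g h where \<alpha>: "\<alpha> = mat22 d e g h" by (rule mat22_cases)
    have "x = coset_index (mat33 1 0 0 d e 0 g h 1)" "invertible (mat33 1 0 0 d e 0 g h 1)"
      using 1 by (simp_all add: \<alpha> M2_bullet_def coset_index_mat33 invertible_mat33_iff unit_iff
        pi_dvd_diff_iff)
    then show ?thesis by blast
  next
    case (2 c m)
    then have "x = coset_index (mat33 0 1 0 1 0 0 c m 1)" "invertible (mat33 0 1 0 1 0 0 c m 1)"
      by (simp_all add: coset_index_mat33 invertible_mat33_iff unit_iff)
    then show ?thesis by blast
  next
    case (3 c m)
    then have "x = coset_index (mat33 1 0 0 m 0 1 c 1 0)" "invertible (mat33 1 0 0 m 0 1 c 1 0)"
      using pi_nonunit by (simp_all add: coset_index_mat33 invertible_mat33_iff unit_iff)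
    then show ?thesis by blast
  next
    case (4 c)
    then have "x = coset_index (mat33 0 0 1 1 0 0 c 1 0)" "invertible (mat33 0 0 1 1 0 0 c 1 0)"
      using pi_nonunit by (simp_all add: coset_index_mat33 invertible_mat33_iff unit_iff)
    then show ?thesis by blast
  next
    case (5 m)
    then have "x = coset_index (mat33 0 1 0 0 (- m) 1 1 0 0)" "invertible (mat33 0 1 0 0 (- m) 1 1 0 0)"
      using pi_nonunit by (simp_all add: coset_index_mat33 invertible_mat33_iff unit_iff)
    then show ?thesis by blast
  next
    case 6
    then have "x = coset_index (mat33 0 0 1 0 1 0 1 0 0)" "invertible (mat33 0 0 1 0 1 0 1 0 (0::'a))"
      by (simp_all add: coset_index_mat33 invertible_mat33_iff)
    then show ?thesis by blast
  qed
qed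

theorem parametrisation_of_GL3_double_cosets: "\<exists>\<Phi>. parametrises_GL3 P \<Phi>"
proof
  define \<Phi> where "\<Phi> C = coset_index (SOME M. M \<in> C)" for C
  have \<Phi>: "\<Phi> (dc3 M) = coset_index M" for M
  proof -
    have "(SOME N. N \<in> dc3 M) \<in> dc3 M"
      using mem_double_coset_self[OF matrix_group_borel3] by (metis someI)
    then have "dc3 M = dc3 (SOME N. N \<in> dc3 M)"
      by (simp only: double_coset_eq_iff[OF matrix_group_borel3])
    then show ?thesis unfolding \<Phi>_def using coset_index_cong by metis
  qed
  have image: "\<Phi> ` (dc3 ` S) = coset_index ` S" for S by (simp add: image_image \<Phi>)
  \<comment> \<open>Each Bruhat fibre is cut out by one summand \<open>S\<close> of the index type,
    so the statements on fibres follow by intersecting the total image with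
    \<open>S\<close>.\<close>
  have fibre: "\<Phi> ` (dc3 ` {M. invertible M \<and> coset_index M \<in> S}) =
      coset_index ` {M. invertible M} \<inter> S" for S
    unfolding image by blast
  show "parametrises_GL3 P \<Phi>"
    unfolding parametrises_GL3_def
  proof (intro conjI)
    have "inj_on \<Phi> GL3_double_cosets"
    proof (rule inj_onI)
      fix C D assume eq: "\<Phi> C = \<Phi> D"
        and mem: "C \<in> GL3_double_cosets" "D \<in> GL3_double_cosets"
      obtain M where M: "invertible M" "C = dc3 M"
        using mem(1) unfolding GL3_double_cosets_def by blast
      obtain N where N: "invertible N" "D = dc3 N"
        using mem(2) unfolding GL3_double_cosets_def by blast
      have "coset_index M = coset_index N" using eq by (simp only: M N \<Phi>)
      then show "C = D" unfolding M N by (rule dc3_eq_if_coset_index_eq[OF M(1) N(1)])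
    qed
    then show "bij_betw \<Phi> GL3_double_cosets
       (M2_orbits <+> (val P ` P \<times> val P ` P) <+> (val P ` P \<times> val P ` P) <+>
        val P ` P <+> val P ` P <+> {()})"
      unfolding bij_betw_def GL3_double_cosets_def image coset_index_image by blast
    show "\<Phi> ` bruhat_fibre P perm1 = Inl ` M2_orbits"
      unfolding bruhat_fibre_def bruhat_cell_iff fibre coset_index_image by auto
    show "\<Phi> ` bruhat_fibre P perm2 = (Inr \<circ> Inl) ` (val P ` P \<times> val P ` P)"
      unfolding bruhat_fibre_def bruhat_cell_iff fibre coset_index_image by auto
    show "\<Phi> ` bruhat_fibre P perm3 = (Inr \<circ> Inr \<circ> Inl) ` (val P ` P \<times> val P ` P)"
      unfolding bruhat_fibre_def bruhat_cell_iff fibre coset_index_image by auto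
    show "\<Phi> ` bruhat_fibre P perm4 = (Inr \<circ> Inr \<circ> Inr \<circ> Inl) ` (val P ` P)"
      unfolding bruhat_fibre_def bruhat_cell_iff fibre coset_index_image by auto
    show "\<Phi> ` bruhat_fibre P perm5 = (Inr \<circ> Inr \<circ> Inr \<circ> Inr \<circ> Inl) ` (val P ` P)"
      unfolding bruhat_fibre_def bruhat_cell_iff fibre coset_index_image by auto
    show "\<Phi> ` bruhat_fibre P perm6 = (Inr \<circ> Inr \<circ> Inr \<circ> Inr \<circ> Inr) ` {()}"
      unfolding bruhat_fibre_def bruhat_cell_iff fibre coset_index_image by auto
    show "\<forall>g\<in>bruhat_cell P perm1. \<Phi> (dc3 g) = Inl (double_coset borel2 (lower_left g))"
    proof
      fix M assume "M \<in> bruhat_cell P perm1"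
      then have "coset_index M \<in> range Inl" by (simp add: bruhat_cell_iff)
      then show "\<Phi> (dc3 M) = Inl (double_coset borel2 (lower_left M))"
        by (auto simp: \<Phi> coset_index_def Let_def split: if_splits)
    qed
  qed
qed

end


section \<open>Orbits on \<open>M\<^sub>2\<close>\<close>

abbreviation dc2 :: "'a::comm_ring_1^2^2 \<Rightarrow> ('a^2^2) set" where
  "dc2 \<equiv> double_coset borel2"

lemma dc2_eq_iff:
  fixes a b c d :: "'a::comm_ring_1"
  shows "dc2 (mat22 a b c d) = dc2 (mat22 a' b' c' d') \<longleftrightarrow>
    (\<exists>x y z p q r. x dvd 1 \<and> z dvd 1 \<and> p dvd 1 \<and> r dvd 1 \<and>
       a' = (x*a + y*c)*p \<and> b' = (x*a + y*c)*q + (x*b + y*d)*r \<and>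
       c' = z*c*p \<and> d' = z*c*q + z*d*r)" (is "_ \<longleftrightarrow> ?R")
proof -
  have "mat22 a' b' c' d' \<in> dc2 (mat22 a b c d) \<longleftrightarrow> ?R"
  proof
    assume "mat22 a' b' c' d' \<in> dc2 (mat22 a b c d)"
    then obtain X Y where XY: "X \<in> borel2" "Y \<in> borel2" "mat22 a' b' c' d' = X ** mat22 a b c d ** Y"
      unfolding double_coset_def by blast
    obtain x y z where X: "X = mat22 x y 0 z" "x dvd 1" "z dvd 1" using XY(1) by (rule borel2E)
    obtain p q r where Y: "Y = mat22 p q 0 r" "p dvd 1" "r dvd 1" using XY(2) by (rule borel2E)
    have "a' = (x*a + y*c)*p \<and> b' = (x*a + y*c)*q + (x*b + y*d)*r \<and>
       c' = z*c*p \<and> d' = z*c*q + z*d*r"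
      using XY(3) by (simp add: X Y mat22_mult)
    with X Y show ?R by blast
  next
    assume ?R
    then obtain x y z p q r where u: "x dvd 1" "z dvd 1" "p dvd 1" "r dvd 1" and
      "a' = (x*a + y*c)*p" "b' = (x*a + y*c)*q + (x*b + y*d)*r"
       "c' = z*c*p" "d' = z*c*q + z*d*r" by blast
    then have "mat22 a' b' c' d' = mat22 x y 0 z ** mat22 a b c d ** mat22 p q 0 r"
      by (simp add: mat22_mult)
    moreover have "mat22 x y 0 z \<in> borel2" "mat22 p q 0 r \<in> borel2"
      using u by (simp_all add: mat22_in_borel2)
    ultimately show "mat22 a' b' c' d' \<in> dc2 (mat22 a b c d)"
      unfolding double_coset_def by blast
  qed
  then show ?thesis by (simp only: double_coset_eq_iff[OF matrix_group_borel2])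
qed

lemma dc2_eqI:
  fixes a b c d :: "'a::comm_ring_1"
  assumes "x dvd 1" "z dvd 1" "p dvd 1" "r dvd 1"
    and "a' = (x*a + y*c)*p" "b' = (x*a + y*c)*q + (x*b + y*d)*r" "c' = z*c*p" "d' = z*c*q + z*d*r"
  shows "dc2 (mat22 a b c d) = dc2 (mat22 a' b' c' d')"
  unfolding dc2_eq_iff using assms by blast

text \<open>Reflection in the antidiagonal preserves the upper triangular matrices and reverses products.\<close>

lemma dc2_reflect:
  fixes a b c d :: "'a::comm_ring_1"
  assumes "dc2 (mat22 a b c d) = dc2 (mat22 a' b' c' d')"
  shows "dc2 (mat22 d b c a) = dc2 (mat22 d' b' c' a')"
proof -
  obtain x y z p q r where *: "x dvd 1" "z dvd 1" "p dvd 1" "r dvd 1"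
    "a' = (x*a + y*c)*p" "b' = (x*a + y*c)*q + (x*b + y*d)*r"
    "c' = z*c*p" "d' = z*c*q + z*d*r" using assms unfolding dc2_eq_iff by blast
  show ?thesis
    by (rule dc2_eqI[of r p z x _ _ q _ _ y]) (use * in \<open>simp_all add: algebra_simps\<close>)
qed

text \<open>Testing all divisors \<open>t\<close> compares the ideals generated by the first column
  and by the lower left entry: the action scales \<open>c\<close> by units and otherwise only mixes
  multiples of \<open>c\<close> into \<open>a\<close>.\<close>

lemma dc2_common_divisors:
  fixes a b c d :: "'a::comm_ring_1"
  assumes eq: "dc2 (mat22 a b c d) = dc2 (mat22 a' b' c' d')"
  shows "t dvd a \<and> t dvd c \<longleftrightarrow> t dvd a' \<and> t dvd c'" and "t dvd c \<longleftrightarrow> t dvd c'"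
proof -
  have *: "(t dvd a \<and> t dvd c \<longrightarrow> t dvd a' \<and> t dvd c') \<and> (t dvd c \<longrightarrow> t dvd c')"
    if "dc2 (mat22 a b c d) = dc2 (mat22 a' b' c' d')" for a b c d a' b' c' d' :: 'a
    using that unfolding dc2_eq_iff by (auto simp: dvd_mult dvd_mult2)
  show "t dvd a \<and> t dvd c \<longleftrightarrow> t dvd a' \<and> t dvd c'" "t dvd c \<longleftrightarrow> t dvd c'"
    using *[OF eq] *[OF eq[symmetric]] by blast+
qed

context uniformized_local_pir
begin

lemma min_val_eqI:
  assumes "\<And>t. t dvd a \<and> t dvd c \<longleftrightarrow> t dvd a' \<and> t dvd c'"
  shows "min (val P a) (val P c) = min (val P a') (val P c')"
proof -
  have *: "min (val P a) (val P c) \<le> min (val P a') (val P c')"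
    if "\<And>t. t dvd a \<and> t dvd c \<Longrightarrow> t dvd a' \<and> t dvd c'" for a c a' c'
  proof (cases "val P a \<le> val P c")
    case True
    with that[of a] show ?thesis by (simp add: dvd_iff_val)
  next
    case False
    with that[of c] show ?thesis by (simp add: dvd_iff_val)
  qed
  show ?thesis using assms by (intro antisym *) auto
qed

lemma dc2_invariants:
  assumes eq: "dc2 (mat22 a b c d) = dc2 (mat22 a' b' c' d')"
  shows "val P c = val P c'"
    and "min (val P a) (val P c) = min (val P a') (val P c')"
    and "min (val P d) (val P c) = min (val P d') (val P c')"
proof -
  show "val P c = val P c'"
    using dc2_common_divisors(2)[OF eq, of c] dc2_common_divisors(2)[OF eq, of c']
    by (simp add: val_eq_iff_dvd)
  show "min (val P a) (val P c) = min (val P a') (val P c')"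
    using dc2_common_divisors(1)[OF eq] by (rule min_val_eqI)
  \<comment> \<open>The first-column invariant of the reflected matrices.\<close>
  show "min (val P d) (val P c) = min (val P d') (val P c')"
    using dc2_common_divisors(1)[OF dc2_reflect[OF eq]] by (rule min_val_eqI)
qed

section \<open>Representatives with nonzero entries and their equivalence\<close>

definition rep :: "nat \<Rightarrow> nat \<Rightarrow> nat \<Rightarrow> 'a \<Rightarrow> 'a^2^2" where
  "rep i j l u = mat22 (\<pi> ^ i) 1 (\<pi> ^ j * u) (\<pi> ^ l)"

text \<open>Adding \<open>- s / (u (1 + s \<pi>\<^sup>j\<^sup>-\<^sup>i))\<close> times the second row to the first and rescaling moves \<open>u\<close> to
  \<open>u + s (u \<pi>\<^sup>j\<^sup>-\<^sup>i - \<pi>\<^sup>l)\<close>.\<close>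

lemma rep_shift:
  assumes "i < j" "0 < l" "u dvd 1"
  shows "dc2 (rep i j l u) = dc2 (rep i j l (u + s * (u * \<pi> ^ (j - i) - \<pi> ^ l)))"
proof -
  let ?A = "\<pi> ^ (j - i)" let ?p = "1 + s * ?A" let ?u' = "u + s * (u * ?A - \<pi> ^ l)"
  have j: "\<pi> ^ j = \<pi> ^ i * ?A" using assms(1) by (simp flip: power_add)
  have dvd: "\<pi> dvd ?A" "\<pi> dvd \<pi> ^ l" using assms by (simp_all add: dvd_power)
  have p: "?p dvd 1" using dvd by simp
  have u': "?u' dvd 1" using dvd assms(3) by simp
  have "u * ?p dvd 1" using p assms(3) by (simp add: units_mult)
  then obtain w where w: "u * ?p * w = 1" "w dvd 1" by (rule unitE)
  have "w * ?u' dvd 1" using w u' by (simp add: units_mult)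
  then obtain r where r: "w * ?u' * r = 1" "r dvd 1" by (rule unitE)
  have c: "w * ?u' * (\<pi> ^ j * u) * ?p = \<pi> ^ j * ?u' * (u * ?p * w)" by (simp only: ac_simps)
  have "(\<pi> ^ i + (- (s * w)) * (\<pi> ^ j * u)) * ?p =
      \<pi> ^ i * ?p - \<pi> ^ i * (s * ?A) * (u * ?p * w)"
    by (simp add: j algebra_simps)
  also have "\<dots> = \<pi> ^ i" by (simp only: w(1)) (simp add: algebra_simps)
  finally have a: "(\<pi> ^ i + (- (s * w)) * (\<pi> ^ j * u)) * ?p = \<pi> ^ i" .
  \<comment> \<open>The row operation turns the top right entry \<open>1\<close> into
    \<open>w * ?u'\<close>. Scaling the second column by its inverse \<open>r\<close> restores the
    \<open>1\<close>, and scaling the second row by \<open>w * ?u'\<close> then preserves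
    \<open>\<pi> ^ l\<close>.\<close>
  have "1 + (- (s * w)) * \<pi> ^ l = u * ?p * w + (- (s * w)) * \<pi> ^ l" by (simp only: w(1))
  also have "\<dots> = w * ?u'" by (simp add: algebra_simps)
  finally have b: "1 + (- (s * w)) * \<pi> ^ l = w * ?u'" .
  show ?thesis
    unfolding rep_def
  proof (rule dc2_eqI[of 1 "w * ?u'" ?p r _ _ "- (s * w)" _ _ 0])
    show "1 dvd (1::'a)" by simp
    show "w * ?u' dvd 1" "?p dvd 1" "r dvd 1" by fact+
    show "\<pi> ^ i = (1 * \<pi> ^ i + - (s * w) * (\<pi> ^ j * u)) * ?p" using a by simp
    show "1 = (1 * \<pi> ^ i + - (s * w) * (\<pi> ^ j * u)) * 0 + (1 * 1 + - (s * w) * \<pi> ^ l) * r"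
      using b r by (simp only: mult_1_left mult_zero_right add_0_left)
    show "\<pi> ^ j * ?u' = w * ?u' * (\<pi> ^ j * u) * ?p" using c w(1) by simp
    show "\<pi> ^ l = w * ?u' * (\<pi> ^ j * u) * 0 + w * ?u' * \<pi> ^ l * r"
    proof -
      have "w * ?u' * \<pi> ^ l * r = \<pi> ^ l * (w * ?u' * r)" by (simp only: ac_simps)
      with r show ?thesis by simp
    qed
  qed
qed

lemma rep_shift':
  assumes "l < j" "0 < i" "u dvd 1"
  shows "dc2 (rep i j l u) = dc2 (rep i j l (u + s * (u * \<pi> ^ (j - l) - \<pi> ^ i)))"
  using dc2_reflect[OF rep_shift[OF assms, unfolded rep_def]] by (simp add: rep_def)

text \<open>\<open>X\<close> and \<open>W\<close> collect the factors that appear at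
  \<open>\<pi> ^ i\<close> and \<open>\<pi> ^ l\<close>. Powers of \<open>\<pi>\<close> cannot be
  cancelled, so \<open>X * p\<close> and \<open>z * W\<close> act as \<open>1\<close> only on
  multiples of \<open>\<pi> ^ j\<close>, which gives
  \<open>\<pi> ^ j * u' * (X * W) = \<pi> ^ j * u\<close>. That the top right entry stays
  \<open>1\<close> then writes \<open>X * W - 1\<close> as a combination of the two
  generators.\<close>

lemma rep_eq_imp:
  assumes "i < j" "l < j" and eq: "dc2 (rep i j l u) = dc2 (rep i j l u')"
  shows "\<exists>s t. \<pi> ^ j * (u' - u) =
    \<pi> ^ j * (s * (u * \<pi> ^ (j - i) - \<pi> ^ l) + t * (u * \<pi> ^ (j - l) - \<pi> ^ i))"
proof -
  let ?A = "\<pi> ^ (j - i)" and ?B = "\<pi> ^ (j - l)" and ?J = "\<pi> ^ j"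
  have j: "?J = \<pi> ^ i * ?A" "?J = \<pi> ^ l * ?B" using assms(1,2) by (simp_all flip: power_add)
  obtain x y z p q r where
    a: "\<pi> ^ i = (x * \<pi> ^ i + y * (?J * u)) * p" and
    b: "1 = (x * \<pi> ^ i + y * (?J * u)) * q + (x * 1 + y * \<pi> ^ l) * r" and
    c: "?J * u' = z * (?J * u) * p" and
    d: "\<pi> ^ l = z * (?J * u) * q + z * \<pi> ^ l * r"
    using eq unfolding rep_def dc2_eq_iff by blast
  define X where "X = x + y * u * ?A"
  define W where "W = r + q * u * ?B"
  have iX: "x * \<pi> ^ i + y * (?J * u) = \<pi> ^ i * X"
    unfolding X_def j(1) by (simp add: algebra_simps)
  have lW: "z * (?J * u) * q + z * \<pi> ^ l * r = \<pi> ^ l * (z * W)"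
    unfolding W_def j(2) by (simp add: algebra_simps)
  have JX: "?J * (X * p) = ?J"
  proof -
    have "?J * (X * p) = (\<pi> ^ i * X * p) * ?A" by (simp add: j(1) ac_simps)
    also have "\<pi> ^ i * X * p = \<pi> ^ i" using a[unfolded iX] by (rule sym)
    finally show ?thesis by (simp only: j(1))
  qed
  have JW: "?J * (z * W) = ?J"
  proof -
    have "?J * (z * W) = (\<pi> ^ l * (z * W)) * ?B" by (simp add: j(2) ac_simps)
    also have "\<pi> ^ l * (z * W) = \<pi> ^ l" using d[unfolded lW] by (rule sym)
    finally show ?thesis by (simp only: j(2))
  qed
  have "?J * u' * (X * W) = (?J * (X * p)) * (z * W) * u" using c by (simp add: ac_simps)
  also have "\<dots> = ?J * (z * W) * u" by (simp only: JX)
  also have "\<dots> = ?J * u" by (simp only: JW)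
  finally have u: "?J * u' * (X * W) = ?J * u" .
  have XW: "X * W - 1 = q * X * (u * ?B - \<pi> ^ i) + r * y * (u * ?A - \<pi> ^ l)"
  proof -
    have "X * W - 1 = X * W - (\<pi> ^ i * X * q + (x * 1 + y * \<pi> ^ l) * r)"
      using b[unfolded iX, symmetric] by (simp only:)
    also have "\<dots> = q * X * (u * ?B - \<pi> ^ i) + r * y * (u * ?A - \<pi> ^ l)"
      unfolding W_def by (simp add: algebra_simps) (simp add: X_def algebra_simps)
    finally show ?thesis .
  qed
  have "?J * (u' - u) = ?J * u' - ?J * u' * (X * W)" by (simp only: u right_diff_distrib)
  also have "\<dots> = ?J * (- u' * (X * W - 1))" by (simp add: algebra_simps)
  also have "\<dots> = ?J * ((- u' * r * y) * (u * ?A - \<pi> ^ l) + (- u' * q * X) * (u * ?B - \<pi> ^ i))"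
    unfolding XW by (simp add: algebra_simps)
  finally show ?thesis by blast
qed

end


subsection \<open>The index of an orbit\<close>

lemma enat_shift_le_iff:
  fixes a b k :: enat
  assumes "enat j < k"
  shows "min (enat j + a) k \<le> min (enat j + b) k \<longleftrightarrow> min a (k - enat j) \<le> b"
  using assms by (cases k; cases a; cases b) (auto simp: min_def)

lemma enat_min_shift:
  fixes v K :: enat
  shows "min (enat e + min v K) K = min (enat e + v) K"
  by (cases v; cases K) (auto simp: min_def)

text \<open>The positive margin \<open>e\<close> makes the cutoff \<open>enat e + d\<close> exceed a
  \<open>d\<close> below \<open>K\<close>, so that such a \<open>d\<close> is a true value and not
  an effect of truncation; only \<open>d = K\<close> can arise by capping.\<close>

lemma enat_min_fixpoint_iff:
  fixes v K d :: enat
  assumes "d \<le> K" "0 < e"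
  shows "min v (min (enat e + d) K) = d \<longleftrightarrow> d = min v K"
  using assms by (cases v; cases K; cases d) (auto simp: min_def)

lemma min_min_absorb:
  fixes x y k K :: enat
  assumes "K \<le> k"
  shows "min (min (min x k) (min y k)) K = min (min x y) K"
  using assms by (simp add: min.assoc min.left_commute min.absorb2)

lemma enat_diff_le: "k - enat j \<le> k"
  by (cases k) auto

lemma image_minus_residue_class: "(\<lambda>x. x - 1) ` residue_class I a = residue_class I (a - 1)"
  for a :: "'a::comm_ring_1"
proof -
  have "x \<in> (\<lambda>x. x - 1) ` residue_class I a" if "x \<in> residue_class I (a - 1)" for x
    using that by (intro image_eqI[of _ _ "x + 1"]) (simp_all add: residue_class_def algebra_simps)
  then show ?thesis by (auto simp: residue_class_def algebra_simps)
qed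

context uniformized_local_pir
begin

lemma le_val_add:
  assumes "n \<le> val P x" "n \<le> val P y"
  shows "n \<le> val P (x + y)" "n \<le> val P (x - y)"
proof -
  have "n \<le> k" using assms(1) val_le order_trans by blast
  then obtain t where t: "val P t = n" by (rule val_surj)
  have "t dvd x" "t dvd y" using assms by (simp_all add: dvd_iff_val t)
  then have "t dvd x + y" "t dvd x - y" by simp_all
  then show "n \<le> val P (x + y)" "n \<le> val P (x - y)" by (simp_all add: dvd_iff_val t)
qed

lemma min_val_cong:
  assumes "n \<le> val P (x - y)"
  shows "min (val P x) n = min (val P y) n"
proof (intro antisym min.boundedI min.cobounded2)
  have "min (val P x) n \<le> val P (x - (x - y))"
    by (rule le_val_add(2)[OF min.cobounded1 min.coboundedI2[OF assms]])
  then show "min (val P x) n \<le> val P y" by simp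
  have "min (val P y) n \<le> val P (y + (x - y))"
    by (rule le_val_add(1)[OF min.cobounded1 min.coboundedI2[OF assms]])
  then show "min (val P y) n \<le> val P x" by simp
qed

lemma power_mult_dvd_iff:
  assumes "enat j < k"
  shows "\<pi> ^ j * x dvd \<pi> ^ j * y \<longleftrightarrow> min (val P x) (k - enat j) \<le> val P y"
  unfolding dvd_iff_val val_power_mult using assms by (rule enat_shift_le_iff)

text \<open>Of the two generators one divides the other, so their ideal is determined by the smaller
  valuation, and a single shift by the generator of smaller valuation suffices for the
  converse.\<close>

lemma rep_eq_iff:
  assumes ij: "0 < i" "i < j" "0 < l" "l < j" "enat j < k" and u: "u dvd 1" "u' dvd 1"
  shows "dc2 (rep i j l u) = dc2 (rep i j l u') \<longleftrightarrow>
    min (min (val P (u * \<pi> ^ (j - i) - \<pi> ^ l)) (val P (u * \<pi> ^ (j - l) - \<pi> ^ i))) (k - enat j)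
      \<le> val P (u' - u)" (is "?L \<longleftrightarrow> min (min (val P ?E) (val P ?F)) _ \<le> _")
proof
  assume ?L
  then obtain s t where st: "\<pi> ^ j * (u' - u) = \<pi> ^ j * (s * ?E + t * ?F)"
    using rep_eq_imp ij by blast
  obtain t where t: "val P t = min (val P ?E) (val P ?F)"
    using val_surj[of "min (val P ?E) (val P ?F)"] val_le by (auto simp: min_le_iff_disj)
  then have "t dvd ?E" "t dvd ?F" by (simp_all add: dvd_iff_val)
  then have "\<pi> ^ j * t dvd \<pi> ^ j * (u' - u)" unfolding st by (simp add: mult_dvd_mono)
  then show "min (min (val P ?E) (val P ?F)) (k - enat j) \<le> val P (u' - u)"
    by (simp add: power_mult_dvd_iff[OF ij(5)] t)
next
  assume le: "min (min (val P ?E) (val P ?F)) (k - enat j) \<le> val P (u' - u)"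
  show ?L
  proof (cases "val P ?E \<le> val P ?F")
    case True
    then have "\<pi> ^ j * ?E dvd \<pi> ^ j * (u' - u)" using le by (simp add: power_mult_dvd_iff[OF ij(5)])
    then obtain s where "\<pi> ^ j * (u' - u) = \<pi> ^ j * ?E * s" by (rule dvdE)
    then have "\<pi> ^ j * u' = \<pi> ^ j * (u + s * ?E)" by (simp add: algebra_simps)
    then have "rep i j l u' = rep i j l (u + s * ?E)" by (simp add: rep_def)
    then show ?thesis using rep_shift[OF ij(2,3) u(1)] by simp
  next
    case False
    then have "\<pi> ^ j * ?F dvd \<pi> ^ j * (u' - u)" using le by (simp add: power_mult_dvd_iff[OF ij(5)])
    then obtain s where "\<pi> ^ j * (u' - u) = \<pi> ^ j * ?F * s" by (rule dvdE)
    then have "\<pi> ^ j * u' = \<pi> ^ j * (u + s * ?F)" by (simp add: algebra_simps)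
    then have "rep i j l u' = rep i j l (u + s * ?F)" by (simp add: rep_def)
    then show ?thesis using rep_shift'[OF ij(4,1) u(1)] by simp
  qed
qed

lemma val_unit_power_diff:
  assumes "u dvd 1" "a \<noteq> b"
  shows "val P (u * \<pi> ^ a - \<pi> ^ b) = min (enat (min a b)) k"
proof (cases "a < b")
  case True
  then have "u * \<pi> ^ a - \<pi> ^ b = \<pi> ^ a * (u - \<pi> ^ (b - a))"
    by (simp add: algebra_simps flip: power_add)
  moreover have "u - \<pi> ^ (b - a) dvd 1" using True assms by (simp add: dvd_power)
  ultimately show ?thesis using True by (simp add: val_power_unit min_def)
next
  case False
  then have "b < a" using assms by simp
  then have "u * \<pi> ^ a - \<pi> ^ b = \<pi> ^ b * (u * \<pi> ^ (a - b) - 1)"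
    by (simp add: algebra_simps flip: power_add)
  moreover have "u * \<pi> ^ (a - b) - 1 dvd 1"
    using \<open>b < a\<close> by (simp add: unit_perturb_iff(2) dvd_power)
  ultimately show ?thesis using \<open>b < a\<close> by (simp add: val_power_unit min_def)
qed

text \<open>\<open>defect\<close> is the \<open>\<delta>\<close> of the component that contains \<open>u\<close>, and \<open>precision\<close> the exponent \<open>m\<close> of
  the ring \<open>A\<^sub>m\<close> in which \<open>u\<close> is to be read there.\<close>

definition defect :: "nat \<Rightarrow> 'a \<Rightarrow> enat" where
  "defect j u = min (val P (u - 1)) (k - enat j)"

definition precision :: "nat \<Rightarrow> nat \<Rightarrow> nat \<Rightarrow> 'a \<Rightarrow> enat" where
  "precision i j l u =
    min (enat (eps i j l) + (if i + l = j then defect j u else 0)) (k - enat j)"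

lemma rep_eq_iff_precision:
  assumes ij: "0 < i" "i < j" "0 < l" "l < j" "enat j < k" and u: "u dvd 1" "u' dvd 1"
  shows "dc2 (rep i j l u) = dc2 (rep i j l u') \<longleftrightarrow> precision i j l u \<le> val P (u' - u)"
proof -
  have "min (min (val P (u * \<pi> ^ (j - i) - \<pi> ^ l)) (val P (u * \<pi> ^ (j - l) - \<pi> ^ i))) (k - enat j)
      = precision i j l u"
  proof (cases "i + l = j")
    case True
    then have "u * \<pi> ^ (j - i) - \<pi> ^ l = \<pi> ^ l * (u - 1)" "u * \<pi> ^ (j - l) - \<pi> ^ i = \<pi> ^ i * (u - 1)"
      by (auto simp: algebra_simps)
    moreover have "eps i j l = min l i" using True by (auto simp: eps_def min_def)
    moreover have "min (enat l + v) (enat i + v) = enat (min l i) + v" for v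
      by (cases v) (auto simp: min_def)
    ultimately show ?thesis
      using True by (simp only: precision_def defect_def enat_min_shift val_power_mult
          min_min_absorb[OF enat_diff_le] simp_thms if_True)
  next
    case False
    then have "j - i \<noteq> l" "j - l \<noteq> i" using ij by auto
    moreover have "eps i j l = min (min (j - i) l) (min (j - l) i)"
      by (simp add: eps_def ac_simps)
    ultimately show ?thesis
      using False by (simp only: precision_def val_unit_power_diff[OF u(1)]
          min_min_absorb[OF enat_diff_le] simp_thms if_False add_0_right min_enat_simps)
  qed
  then show ?thesis using rep_eq_iff[OF assms] by simp
qed

text \<open>The lower bound lets units of the quotient lift to units of \<open>A\<close>; the upper
  bound lets \<open>ideal_epow\<close> be described by \<open>val\<close>.\<close>

lemma precision_props:
  assumes "0 < i" "i < j" "0 < l" "l < j" "enat j < k"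
  shows "1 \<le> precision i j l u" "precision i j l u \<le> k"
proof -
  have "0 < eps i j l" using assms by (simp add: eps_def)
  then show "1 \<le> precision i j l u"
    unfolding precision_def using assms(5)
    by (cases k; cases "defect j u") (auto simp: one_enat_def zero_enat_def)
  show "precision i j l u \<le> k" unfolding precision_def by (intro min.coboundedI2 enat_diff_le)
qed

section \<open>Units and valuations in the quotients\<close>

lemma residue_class_eq_iff:
  assumes "m \<le> k"
  shows "residue_class (ideal_epow P m) x = residue_class (ideal_epow P m) y \<longleftrightarrow> m \<le> val P (y - x)"
    and "y \<in> residue_class (ideal_epow P m) x \<longleftrightarrow> m \<le> val P (y - x)"
proof -
  have mem: "y \<in> residue_class (ideal_epow P m) x \<longleftrightarrow> m \<le> val P (y - x)" for x y
    using assms by (simp add: residue_class_def ideal_epow_iff)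
  then show "y \<in> residue_class (ideal_epow P m) x \<longleftrightarrow> m \<le> val P (y - x)" .
  show "residue_class (ideal_epow P m) x = residue_class (ideal_epow P m) y \<longleftrightarrow> m \<le> val P (y - x)"
  proof
    assume "residue_class (ideal_epow P m) x = residue_class (ideal_epow P m) y"
    moreover have "y \<in> residue_class (ideal_epow P m) y" using assms by (simp add: mem)
    ultimately show "m \<le> val P (y - x)" using mem by blast
  next
    assume le: "m \<le> val P (y - x)"
    have "m \<le> val P (z - x) \<longleftrightarrow> m \<le> val P (z - y)" for z
      using le_val_add(1)[OF _ le, of "z - y"] le_val_add(2)[OF _ le, of "z - x"] by auto
    then show "residue_class (ideal_epow P m) x = residue_class (ideal_epow P m) y"
      by (auto simp: mem)
  qed
qed

text \<open>As \<open>1 \<le> m\<close>, an inverse modulo the \<open>m\<close>-th power is an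
  inverse modulo \<open>P\<close>, and by locality this makes \<open>a\<close> a unit of
  \<open>A\<close>.\<close>

lemma quot_units_iff:
  assumes "1 \<le> m" "m \<le> k"
  shows "X \<in> quot_units P m \<longleftrightarrow> (\<exists>a. a dvd 1 \<and> X = residue_class (ideal_epow P m) a)"
proof -
  have "(\<exists>b. residue_class (ideal_epow P m) (a * b) = residue_class (ideal_epow P m) 1) \<longleftrightarrow> a dvd 1" for a
  proof
    assume "\<exists>b. residue_class (ideal_epow P m) (a * b) = residue_class (ideal_epow P m) 1"
    then obtain b where "m \<le> val P (1 - a * b)" using residue_class_eq_iff[OF assms(2)] by blast
    then have "\<pi> dvd 1 - a * b" using assms(1) nonunit_iff_val order_trans by blast
    then have "a * b dvd 1" using unit_cong[of 1 "a * b"] by simp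
    then show "a dvd 1" by (simp add: units_mult)
  next
    assume "a dvd 1"
    then obtain b where "a * b = 1" by (rule unitE)
    then show "\<exists>b. residue_class (ideal_epow P m) (a * b) = residue_class (ideal_epow P m) 1" by metis
  qed
  then show ?thesis by (auto simp: quot_units_def)
qed

text \<open>If \<open>val P x\<close> is a number \<open>n\<close> below \<open>m\<close>, an
  element of the class divisible by a power beyond \<open>\<pi> ^ n\<close> would, since
  \<open>n + 1 \<le> m\<close>, make \<open>x\<close> itself divisible by
  \<open>\<pi> ^ (n + 1)\<close>.\<close>

lemma quot_val_residue_class:
  assumes "m \<le> k"
  shows "quot_val P m (residue_class (ideal_epow P m) x) = min (val P x) m"
proof (cases "m \<le> val P x")
  case True
  then show ?thesis
    using residue_class_eq_iff(1)[OF assms, of 0 x] by (simp add: quot_val_def min_def)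
next
  case False
  then have lt: "val P x < m" by simp
  then obtain n where n: "val P x = enat n" by (cases "val P x") auto
  have "(GREATEST r. residue_class (ideal_epow P m) x \<in> residue_class (ideal_epow P m) ` ideal_pow P r) = n"
  proof (rule Greatest_equality)
    have "\<pi> ^ n dvd x" by (simp add: dvd_iff_val val_power n)
    then show "residue_class (ideal_epow P m) x \<in> residue_class (ideal_epow P m) ` ideal_pow P n"
      by (simp add: ideal_pow_iff)
  next
    fix r assume "residue_class (ideal_epow P m) x \<in> residue_class (ideal_epow P m) ` ideal_pow P r"
    then obtain y where y: "\<pi> ^ r dvd y" "m \<le> val P (y - x)"
      using residue_class_eq_iff(1)[OF assms] by (auto simp: ideal_pow_iff)
    show "r \<le> n"
    proof (rule ccontr)
      assume "\<not> r \<le> n"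
      then have "enat (Suc n) \<le> enat r" by simp
      moreover have "enat (Suc n) \<le> m" using lt n by (cases m) auto
      moreover have "min (enat r) k \<le> val P y" using y(1) by (simp add: dvd_iff_val val_power)
      moreover from calculation have "enat (Suc n) \<le> min (enat r) k" using assms by auto
      ultimately have "enat (Suc n) \<le> val P y" "enat (Suc n) \<le> val P (y - x)"
        using y(2) order_trans by blast+
      then have "enat (Suc n) \<le> val P (y - (y - x))" by (rule le_val_add)
      then show False using n by simp
    qed
  qed
  moreover have "residue_class (ideal_epow P m) x \<noteq> residue_class (ideal_epow P m) 0"
    using residue_class_eq_iff(1)[OF assms, of 0 x] lt by auto
  ultimately show ?thesis using lt n by (simp add: quot_val_def min.absorb1)
qed

section \<open>The indices belonging to the representatives\<close>

definition main_index :: "nat \<Rightarrow> nat \<Rightarrow> nat \<Rightarrow> 'a \<Rightarrow> 'a orbit_index" where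
  "main_index i j l u =
    (let X = residue_class (ideal_epow P (precision i j l u)) u in
     if i + l = j then special i j l (defect j u) X else generic i j l X)"

lemma defect_le: "defect j u \<le> k - enat j"
  by (simp add: defect_def)

text \<open>In \<open>special_index\<close> the modulus depends on \<open>\<delta>\<close>, and
  \<open>\<delta>\<close> is in turn the valuation of \<open>u - 1\<close> at that modulus. This
  resolves the circularity: \<open>defect j u\<close> is the only solution.\<close>

lemma defect_eq_iff:
  assumes "0 < i" "i < j" "0 < l" "l < j" "enat j < k" "i + l = j" "d \<le> k - enat j"
  shows "min (val P (u - 1)) (min (enat (eps i j l) + d) (k - enat j)) = d \<longleftrightarrow> d = defect j u"
  unfolding defect_def using assms by (intro enat_min_fixpoint_iff) (simp_all add: eps_def)

lemma main_index_eq_iff: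
  assumes ij: "0 < i" "i < j" "0 < l" "l < j" "enat j < k" and u: "u dvd 1" "u' dvd 1"
  shows "main_index i j l u = main_index i j l u' \<longleftrightarrow> precision i j l u \<le> val P (u' - u)"
proof (cases "i + l = j")
  case False
  then have "precision i j l u' = precision i j l u" by (simp add: precision_def)
  with False show ?thesis
    using residue_class_eq_iff(1)[OF precision_props(2)[OF ij]] by (simp add: main_index_def)
next
  case True
  \<comment> \<open>For \<open>i + l = j\<close> the precision itself depends on \<open>u\<close>,
    so equality of the defects has to come before residue classes can be compared.\<close>
  have eq: "defect j u' = defect j u" if "precision i j l u \<le> val P (u' - u)"
  proof -
    have "min (val P (u' - 1)) (precision i j l u) = min (val P (u - 1)) (precision i j l u)"
      using that by (intro min_val_cong) simp
    then show ?thesis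
      using defect_eq_iff[OF ij True defect_le, of u u] defect_eq_iff[OF ij True defect_le, of u' u] True
      by (simp add: precision_def)
  qed
  have "main_index i j l u = main_index i j l u' \<longleftrightarrow> defect j u' = defect j u \<and>
      residue_class (ideal_epow P (precision i j l u)) u =
      residue_class (ideal_epow P (precision i j l u)) u'"
  proof (cases "defect j u' = defect j u")
    case eq: True
    then have "precision i j l u' = precision i j l u" by (simp add: precision_def)
    with True eq show ?thesis by (simp add: main_index_def)
  next
    case False
    with True show ?thesis by (simp add: main_index_def)
  qed
  then show ?thesis
    unfolding residue_class_eq_iff(1)[OF precision_props(2)[OF ij]] using eq by blast
qed

definition main_range :: "(nat \<times> nat \<times> nat \<times> 'a) set" where
  "main_range = {(i, j, l, u). 0 < i \<and> i < j \<and> 0 < l \<and> l < j \<and> enat j < k \<and> u dvd 1}"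

lemma generic_in_orbit_indices_iff:
  "generic i j l X \<in> orbit_indices P k \<longleftrightarrow>
    i + l \<noteq> j \<and> (\<exists>u. (i, j, l, u) \<in> main_range \<and>
      X = residue_class (ideal_epow P (precision i j l u)) u)" (is "?L \<longleftrightarrow> ?R")
proof (cases "0 < i \<and> i < j \<and> 0 < l \<and> l < j \<and> enat j < k \<and> i + l \<noteq> j")
  case True
  let ?m = "min (enat (eps i j l)) (k - enat j)"
  have m: "precision i j l u = ?m" for u using True by (simp add: precision_def)
  have "1 \<le> ?m" "?m \<le> k" using precision_props[of i j l] True m by metis+
  then have "X \<in> quot_units P ?m \<longleftrightarrow> (\<exists>u. u dvd 1 \<and> X = residue_class (ideal_epow P ?m) u)"
    by (rule quot_units_iff)
  moreover have "?L \<longleftrightarrow> X \<in> quot_units P ?m"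
    using True by (auto simp: orbit_indices_def generic_index_def)
  ultimately show ?thesis using True by (simp add: m main_range_def)
next
  case False
  then show ?thesis by (auto simp: orbit_indices_def generic_index_def main_range_def)
qed

lemma special_in_orbit_indices_iff:
  "special i j l \<delta> X \<in> orbit_indices P k \<longleftrightarrow>
    i + l = j \<and> (\<exists>u. (i, j, l, u) \<in> main_range \<and> \<delta> = defect j u \<and>
      X = residue_class (ideal_epow P (precision i j l u)) u)" (is "?L \<longleftrightarrow> ?R")
proof (cases "0 < i \<and> i < j \<and> 0 < l \<and> l < j \<and> enat j < k \<and> i + l = j \<and> \<delta> \<le> k - enat j")
  case True
  let ?m = "min (enat (eps i j l) + \<delta>) (k - enat j)"
  have "1 \<le> ?m"
    using True by (cases k; cases \<delta>) (auto simp: eps_def one_enat_def)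
  moreover have "?m \<le> k" using enat_diff_le[of k j] by (simp add: min.coboundedI2)
  ultimately have units: "X \<in> quot_units P ?m \<longleftrightarrow> (\<exists>u. u dvd 1 \<and> X = residue_class (ideal_epow P ?m) u)"
    by (rule quot_units_iff)
  have "quot_val P ?m ((\<lambda>x. x - 1) ` residue_class (ideal_epow P ?m) u) = \<delta> \<longleftrightarrow> \<delta> = defect j u" for u
    unfolding image_minus_residue_class quot_val_residue_class[OF \<open>?m \<le> k\<close>]
    using True by (intro defect_eq_iff) auto
  then have "X \<in> quot_units_at P ?m \<delta> \<longleftrightarrow>
      (\<exists>u. u dvd 1 \<and> \<delta> = defect j u \<and> X = residue_class (ideal_epow P ?m) u)"
    unfolding quot_units_at_def using units by auto
  moreover have "?L \<longleftrightarrow> X \<in> quot_units_at P ?m \<delta>"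
    using True by (auto simp: orbit_indices_def special_index_def)
  moreover have "precision i j l u = ?m" if "\<delta> = defect j u" for u
    using that True by (simp add: precision_def)
  ultimately show ?thesis using True by (auto simp: main_range_def)
next
  case False
  then show ?thesis
    using defect_le by (auto simp: orbit_indices_def special_index_def main_range_def)
qed

lemma main_index_in_orbit_indices:
  assumes "(i, j, l, u) \<in> main_range"
  shows "main_index i j l u \<in> orbit_indices P k"
  using assms generic_in_orbit_indices_iff special_in_orbit_indices_iff
  by (auto simp: main_index_def Let_def)

lemma degenerate_in_orbit_indices_iff: "degenerate d \<in> orbit_indices P k \<longleftrightarrow> d \<in> D_set k"
  by (auto simp: orbit_indices_def)

lemma orbit_indices_cases:
  assumes "x \<in> orbit_indices P k"
  obtains (main) i j l u where "(i, j, l, u) \<in> main_range" "x = main_index i j l u"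
  | (degenerate) d where "d \<in> D_set k" "x = degenerate d"
proof -
  consider i j l X where "x = generic i j l X" | i j l \<delta> X where "x = special i j l \<delta> X"
    | d where "x = degenerate d"
    by (metis obj_sumE surj_pair)
  then show ?thesis
  proof cases
    case 1
    with assms obtain u where "i + l \<noteq> j" "(i, j, l, u) \<in> main_range"
        "X = residue_class (ideal_epow P (precision i j l u)) u"
      unfolding 1 generic_in_orbit_indices_iff by blast
    with 1 show ?thesis by (intro main[of i j l u]) (simp_all add: main_index_def Let_def)
  next
    case 2
    with assms obtain u where "i + l = j" "(i, j, l, u) \<in> main_range" "\<delta> = defect j u"
        "X = residue_class (ideal_epow P (precision i j l u)) u"
      unfolding 2 special_in_orbit_indices_iff by blast
    with 2 show ?thesis by (intro main[of i j l u]) (simp_all add: main_index_def Let_def)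
  next
    case 3
    with assms show ?thesis using degenerate degenerate_in_orbit_indices_iff by blast
  qed
qed

section \<open>Degenerate orbits and the reduction of an arbitrary matrix\<close>

lemma val_mat_mat22: "val_mat P (mat22 a b c d) = mat22 (val P a) (val P b) (val P c) (val P d)"
  by (simp add: val_mat_def vec_eq_iff forall_2)

lemma mat22_in_D_set:
  "mat22 i x j l \<in> D_set k \<longleftrightarrow> x = 0 \<and> {i, j, l} \<subseteq> {1..k} \<and>
     (j = k \<or> (i < j \<and> j < k \<and> l = k) \<or> (l < j \<and> j < k \<and> i = k) \<or> (j < k \<and> i = k \<and> l = k))"
  by (auto simp: D_set_def)

lemma mat22_in_M2_bullet:
  "mat22 a b c d \<in> M2_bullet \<longleftrightarrow> b dvd 1 \<and> \<pi> dvd a \<and> \<pi> dvd c \<and> \<pi> dvd d"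
  by (simp add: M2_bullet_def unit_iff)

text \<open>Diagonal matrices scale the entries by \<open>x * p\<close>, \<open>x * r\<close>,
  \<open>z * p\<close>, \<open>z * r\<close>, four factors bound by one relation, so three entries
  can be rescaled freely. A vanishing entry absorbs the fourth factor, which is why degenerate
  orbits depend on valuations only.\<close>

lemma scaled_orbit_eq:
  fixes a b c d :: 'a
  assumes "a = 0 \<or> c = 0 \<or> d = 0" and u: "s dvd 1" "w dvd 1" "h dvd 1" "t dvd 1"
  shows "dc2 (mat22 a b c d) = dc2 (mat22 (s * a) (w * b) (h * c) (t * d))"
proof -
  obtain s' w' t' where inv: "s' * s = 1" "s' dvd 1" "w' * w = 1" "w' dvd 1" "t' * t = 1" "t' dvd 1"
    using rescale u by metis
  consider "d = 0" | "c = 0" | "a = 0" using assms by blast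
  then show ?thesis
  proof cases
    case 1
    have "h * c = h * (s' * s) * c" using inv by simp
    with 1 show ?thesis using u inv
      by (intro dc2_eqI[of 1 "h * s'" s w _ _ 0 _ _ 0]) (simp_all add: units_mult ac_simps)
  next
    case 2
    have "t * d = t * (w' * w) * d" using inv by simp
    with 2 show ?thesis using u inv
      by (intro dc2_eqI[of 1 "t * w'" s w _ _ 0 _ _ 0]) (simp_all add: units_mult ac_simps)
  next
    case 3
    have "t * d = t * (w' * w) * d" "h * c = (w' * w) * (t' * t) * h * c" using inv by simp_all
    with 3 show ?thesis using u inv
      by (intro dc2_eqI[of 1 "t * w'" "h * t' * w" w _ _ 0 _ _ 0]) (simp_all add: units_mult ac_simps)
  qed
qed

text \<open>A diagonal entry divisible by \<open>c\<close> is cleared with \<open>c\<close>, by a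
  row operation for \<open>a\<close> and a column operation for \<open>d\<close>; the top right
  entry changes only by a nonunit.\<close>

lemma M2_bullet_reduce:
  assumes b: "b dvd 1" and non: "\<pi> dvd a" "\<pi> dvd c" "\<pi> dvd d"
  obtains a' b' d' where "dc2 (mat22 a b c d) = dc2 (mat22 a' b' c d')"
    "b' dvd 1" "\<pi> dvd a'" "\<pi> dvd d'" "c dvd a' \<Longrightarrow> a' = 0" "c dvd d' \<Longrightarrow> d' = 0"
proof -
  obtain a1 b1 where 1: "dc2 (mat22 a b c d) = dc2 (mat22 a1 b1 c d)" "b1 dvd 1" "\<pi> dvd a1"
    "c dvd a1 \<longrightarrow> a1 = 0"
  proof (cases "c dvd a")
    case True
    then obtain y where "a = c * y" by (rule dvdE)
    then have "dc2 (mat22 a b c d) = dc2 (mat22 0 (b - y * d) c d)"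
      by (intro dc2_eqI[of 1 1 1 1 _ _ "- y" _ _ 0]) simp_all
    moreover have "b - y * d dvd 1" using b non by simp
    ultimately show ?thesis by (intro that[of 0]) simp_all
  qed (use that b non in blast)
  obtain b2 d2 where "dc2 (mat22 a1 b1 c d) = dc2 (mat22 a1 b2 c d2)" "b2 dvd 1" "\<pi> dvd d2"
    "c dvd d2 \<longrightarrow> d2 = 0"
  proof (cases "c dvd d")
    case True
    then obtain y where "d = c * y" by (rule dvdE)
    then have "dc2 (mat22 a1 b1 c d) = dc2 (mat22 a1 (b1 - y * a1) c 0)"
      by (intro dc2_eqI[of 1 1 1 1 _ _ 0 _ _ "- y"]) simp_all
    moreover have "b1 - y * a1 dvd 1" using 1 by simp
    ultimately show ?thesis by (intro that[of _ 0]) simp_all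
  qed (use that 1 non in blast)
  with 1 that show ?thesis by metis
qed

text \<open>A relation and not a function: a residue class has many lifts and a valuation matrix
  many realisations. The bijection follows once every index and every orbit occurs and equal indices
  correspond to equal orbits.\<close>

definition represents :: "'a orbit_index \<Rightarrow> 'a^2^2 \<Rightarrow> bool" where
  "represents x \<alpha> \<longleftrightarrow>
     (\<exists>i j l u. (i, j, l, u) \<in> main_range \<and> x = main_index i j l u \<and> \<alpha> = rep i j l u) \<or>
     (\<exists>d\<in>D_set k. x = degenerate d \<and> \<alpha> \<in> M2_bullet \<and> val_mat P \<alpha> = d)"

lemma representsE:
  assumes "represents x \<alpha>"
  obtains (main) i j l u where "(i, j, l, u) \<in> main_range" "x = main_index i j l u" "\<alpha> = rep i j l u"
  | (degenerate) a b c d where "mat22 (val P a) 0 (val P c) (val P d) \<in> D_set k"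
      "x = degenerate (mat22 (val P a) 0 (val P c) (val P d))" "\<alpha> = mat22 a b c d" "b dvd 1"
proof -
  obtain a b c d where \<alpha>: "\<alpha> = mat22 a b c d" by (rule mat22_cases)
  have "val P b = 0" if "\<alpha> \<in> M2_bullet"
    using that by (simp add: \<alpha> mat22_in_M2_bullet unit_iff_val)
  with assms \<alpha> main degenerate show ?thesis
    unfolding represents_def by (auto simp: val_mat_mat22 mat22_in_M2_bullet)
qed

lemma represents_M2_bullet:
  assumes "represents x \<alpha>"
  shows "\<alpha> \<in> M2_bullet"
  using assms unfolding represents_def
  by (auto simp: rep_def mat22_in_M2_bullet main_range_def dvd_power)

lemma every_orbit_represented:
  assumes "\<alpha> \<in> M2_bullet"
  shows "\<exists>x \<beta>. represents x \<beta> \<and> dc2 \<alpha> = dc2 \<beta>"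
proof -
  obtain a0 b0 c d0 where \<alpha>: "\<alpha> = mat22 a0 b0 c d0" by (rule mat22_cases)
  with assms have c: "\<pi> dvd c" and "b0 dvd 1" "\<pi> dvd a0" "\<pi> dvd d0"
    by (simp_all add: mat22_in_M2_bullet)
  then obtain a b d where abd: "dc2 \<alpha> = dc2 (mat22 a b c d)"
    "b dvd 1" "\<pi> dvd a" "\<pi> dvd d" "c dvd a \<Longrightarrow> a = 0" "c dvd d \<Longrightarrow> d = 0"
    unfolding \<alpha> by (metis M2_bullet_reduce)
  show ?thesis
  proof (cases "a = 0 \<or> c = 0 \<or> d = 0")
    case True
    \<comment> \<open>After the reduction each diagonal valuation is either below that of
      \<open>c\<close> or equal to \<open>k\<close>. Both diagonal entries zero with
      \<open>c\<close> nonzero gives the case \<open>i = l = k\<close>,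
      \<open>j < k\<close>.\<close>
    have "mat22 (val P a) 0 (val P c) (val P d) \<in> D_set k"
    proof -
      have "1 \<le> val P a" "1 \<le> val P c" "1 \<le> val P d"
        using abd(3,4) c by (simp_all only: nonunit_iff_val)
      moreover have "val P c \<le> val P a \<longrightarrow> val P a = k" "val P c \<le> val P d \<longrightarrow> val P d = k"
        using abd(5,6) by (simp_all only: dvd_iff_val val_eq_length_iff) blast+
      moreover have "val P a = k \<or> val P c = k \<or> val P d = k"
        using True by (simp only: val_eq_length_iff)
      moreover have "val P a \<le> k" "val P c \<le> k" "val P d \<le> k" by (rule val_le)+
      ultimately show ?thesis
        unfolding mat22_in_D_set by (simp del: val_0) (metis le_less_linear le_less)
    qed
    moreover have "mat22 a b c d \<in> M2_bullet" using abd c by (simp add: mat22_in_M2_bullet)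
    moreover have "val_mat P (mat22 a b c d) = mat22 (val P a) 0 (val P c) (val P d)"
      using abd(2) by (simp add: val_mat_mat22 unit_iff_val)
    ultimately have "represents (degenerate (mat22 (val P a) 0 (val P c) (val P d))) (mat22 a b c d)"
      unfolding represents_def by blast
    then show ?thesis using abd(1) by blast
  next
    case False
    obtain i s where a: "a = \<pi> ^ i * s" "s dvd 1" "enat i < k" using False decompose by blast
    obtain j h where cj: "c = \<pi> ^ j * h" "h dvd 1" "enat j < k" using False decompose by blast
    obtain l t where d: "d = \<pi> ^ l * t" "t dvd 1" "enat l < k" using False decompose by blast
    have vals: "val P a = enat i" "val P c = enat j" "val P d = enat l"
      using a cj d by (simp_all add: val_power_unit)
    have "\<not> c dvd a" "\<not> c dvd d" using abd(5,6) False by blast+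
    then have "i < j" "l < j" using vals by (simp_all add: dvd_iff_val)
    moreover have "0 < i" "0 < l"
      using abd(3,4) vals by (auto simp: nonunit_iff_val one_enat_def)
    ultimately have range: "(i, j, l, u) \<in> main_range" if "u dvd 1" for u
      using that cj by (simp add: main_range_def)
    obtain s' b' t' where inv: "s' * s = 1" "s' dvd 1" "b' * b = 1" "b' dvd 1" "t' * t = 1" "t' dvd 1"
      using rescale a d abd(2) by metis
    have red: "s * (s' * x) = x" "b * (b' * x) = x" "t * (t' * x) = x"
      "s' * (s * x) = x" "b' * (b * x) = x" "t' * (t * x) = x"
      "b * b' = 1" "s * s' = 1" "t * t' = 1" for x
      using inv by (simp_all flip: mult.assoc add: mult.commute)
    \<comment> \<open>Three of the four unit parts can be scaled away; the quotient of
      \<open>b * h\<close> by \<open>s * t\<close> is what remains.\<close>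
    let ?u = "t' * b * h * s'"
    have "dc2 (mat22 a b c d) = dc2 (rep i j l ?u)"
      unfolding rep_def
      by (rule dc2_eqI[of 1 "t' * b" s' b' _ _ 0 _ _ 0])
        (use inv abd(2) in \<open>simp_all add: a cj d units_mult ac_simps red\<close>)
    moreover have "?u dvd 1" using inv abd(2) cj by (simp add: units_mult)
    then have "represents (main_index i j l ?u) (rep i j l ?u)"
      unfolding represents_def using range by blast
    ultimately show ?thesis using abd(1) by metis
  qed
qed

lemma main_invariants:
  assumes "(i, j, l, u) \<in> main_range" and "dc2 (mat22 a b c d) = dc2 (rep i j l u)"
  shows "val P c = enat j" "min (val P a) (val P c) = enat i" "min (val P d) (val P c) = enat l"
    "enat i < enat j" "enat l < enat j" "enat j < k"
proof -
  have r: "enat i < enat j" "enat l < enat j" "enat j < k" "u dvd 1"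
    using assms(1) by (auto simp: main_range_def)
  then show "enat i < enat j" "enat l < enat j" "enat j < k" by blast+
  have "enat i < k" "enat l < k" using r by (blast intro: less_trans)+
  with r dc2_invariants[OF assms(2)[unfolded rep_def]]
  show "val P c = enat j" "min (val P a) (val P c) = enat i" "min (val P d) (val P c) = enat l"
    by (simp_all add: val_power_unit val_power min.absorb1)
qed

text \<open>Unequal exponents are told apart by the invariants of \<open>dc2_invariants\<close>. For
  equal exponents, equality of indices and of orbits both amount to the same inequality for
  \<open>precision\<close>.\<close>

lemma represents_unique:
  assumes "represents x \<alpha>" "represents y \<beta>"
  shows "x = y \<longleftrightarrow> dc2 \<alpha> = dc2 \<beta>"
  using assms(1)
proof (cases rule: representsE)
  case main1: (main i j l u)
  from assms(2) show ?thesis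
  proof (cases rule: representsE)
    case main2: (main i' j' l' u')
    show ?thesis
    proof (cases "i = i' \<and> j = j' \<and> l = l'")
      case True
      then show ?thesis
        using main1 main2 main_index_eq_iff[of i j l u u'] rep_eq_iff_precision[of i j l u u']
        by (simp add: main_range_def)
    next
      case False
      then have "x \<noteq> y" using main1 main2 by (auto simp: main_index_def Let_def split: if_splits)
      moreover have "dc2 \<alpha> \<noteq> dc2 \<beta>"
      proof
        assume "dc2 \<alpha> = dc2 \<beta>"
        then show False
          using main_invariants[OF main1(1), of "\<pi> ^ i'" 1 "\<pi> ^ j' * u'" "\<pi> ^ l'"]
            main_invariants[OF main2(1), of "\<pi> ^ i'" 1 "\<pi> ^ j' * u'" "\<pi> ^ l'"] main1 main2 False
          by (simp add: rep_def)
      qed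
      ultimately show ?thesis by blast
    qed
  next
    case deg: (degenerate a b c d)
    have "x \<noteq> y" using main1 deg by (simp add: main_index_def Let_def)
    \<comment> \<open>In the first kind of orbit \<open>val P c\<close> is below \<open>k\<close>
      and both minima are strictly below \<open>val P c\<close>. In a degenerate one
      \<open>val P c = k\<close>, or a diagonal entry has valuation \<open>k\<close> and its minimum
      is \<open>val P c\<close>.\<close>
    moreover have "dc2 \<alpha> \<noteq> dc2 \<beta>"
      using main_invariants[OF main1(1), of a b c d] main1 deg
      by (auto simp: mat22_in_D_set min_def split: if_splits)
    ultimately show ?thesis by blast
  qed
next
  case deg1: (degenerate a b c d)
  from assms(2) show ?thesis
  proof (cases rule: representsE)
    case main2: (main i' j' l' u')
    have "x \<noteq> y" using main2 deg1 by (simp add: main_index_def Let_def)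
    moreover have "dc2 \<alpha> \<noteq> dc2 \<beta>"
      using main_invariants[OF main2(1), of a b c d] main2 deg1
      by (auto simp: mat22_in_D_set min_def split: if_splits)
    ultimately show ?thesis by blast
  next
    case deg2: (degenerate a' b' c' d')
    show ?thesis
    proof
      assume "x = y"
      then have "val P a = val P a'" "val P b = val P b'" "val P c = val P c'" "val P d = val P d'"
        using deg1 deg2 by (simp_all add: unit_iff_val)
      then obtain s w h t where *: "s dvd 1" "a' = s * a" "w dvd 1" "b' = w * b"
        "h dvd 1" "c' = h * c" "t dvd 1" "d' = t * d"
        by (metis val_eqE)
      have "a = 0 \<or> c = 0 \<or> d = 0"
        using deg1(1) val_eq_length_iff by (auto simp: mat22_in_D_set)
      then show "dc2 \<alpha> = dc2 \<beta>" unfolding deg1 deg2 * by (rule scaled_orbit_eq) fact+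
    next
      assume "dc2 \<alpha> = dc2 \<beta>"
      then have "dc2 (mat22 a b c d) = dc2 (mat22 a' b' c' d')" by (simp only: deg1 deg2)
      note inv = dc2_invariants[OF this]
      \<comment> \<open>In \<open>D_set\<close> either \<open>j = k\<close>, or each diagonal
        valuation is below \<open>j\<close> or equal to \<open>k\<close>; in every case it can be
        recovered from its minimum with \<open>j\<close>.\<close>
      have "val P a = val P a'" "val P d = val P d'"
        using deg1(1) deg2(1) inv val_le[of a] val_le[of d] val_le[of a'] val_le[of d']
        by (auto simp: mat22_in_D_set min_def split: if_splits)
      then show "x = y" using deg1 deg2 inv by simp
    qed
  qed
qed

section \<open>The parametrisation of the orbits\<close>

lemma orbit_indices_iff_represents: "x \<in> orbit_indices P k \<longleftrightarrow> (\<exists>\<alpha>. represents x \<alpha>)"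
proof
  assume "x \<in> orbit_indices P k"
  then show "\<exists>\<alpha>. represents x \<alpha>"
  proof (cases rule: orbit_indices_cases)
    case (main i j l u)
    then show ?thesis unfolding represents_def by blast
  next
    case (degenerate D)
    then obtain i j l where D: "D = mat22 i 0 j l" and "{i, j, l} \<subseteq> {1..k}"
      by (auto simp: D_set_def)
    then obtain a c d where abd: "val P a = i" "val P c = j" "val P d = l"
      by (metis atLeastAtMost_iff insert_subset val_surj)
    have "mat22 a 1 c d \<in> M2_bullet" "val_mat P (mat22 a 1 c d) = D"
      using \<open>{i, j, l} \<subseteq> {1..k}\<close> abd unit_iff_val[of 1]
      by (simp_all add: D mat22_in_M2_bullet nonunit_iff_val val_mat_mat22)
    then show ?thesis using degenerate unfolding represents_def by blast
  qed
next
  assume "\<exists>\<alpha>. represents x \<alpha>"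
  then show "x \<in> orbit_indices P k"
    unfolding represents_def
    using main_index_in_orbit_indices degenerate_in_orbit_indices_iff by blast
qed

theorem parametrisation_of_M2_orbits: "\<exists>\<Psi>. parametrises_M2 P \<pi> k \<Psi>"
proof
  define \<Psi> where "\<Psi> x = dc2 (SOME \<alpha>. represents x \<alpha>)" for x
  have \<Psi>: "\<Psi> x = dc2 \<alpha>" if "represents x \<alpha>" for x \<alpha>
    unfolding \<Psi>_def using represents_unique[OF someI[of "represents x", OF that] that] by blast
  have inj: "inj_on \<Psi> (orbit_indices P k)"
  proof (rule inj_onI)
    fix x y assume "x \<in> orbit_indices P k" "y \<in> orbit_indices P k" and eq: "\<Psi> x = \<Psi> y"
    then obtain \<alpha> \<beta> where "represents x \<alpha>" "represents y \<beta>"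
      using orbit_indices_iff_represents by blast
    with eq show "x = y" using \<Psi> represents_unique by metis
  qed
  have image: "\<Psi> ` orbit_indices P k = M2_orbits"
  proof (intro subset_antisym subsetI)
    fix C assume "C \<in> \<Psi> ` orbit_indices P k"
    then obtain x \<alpha> where "represents x \<alpha>" "C = \<Psi> x"
      using orbit_indices_iff_represents by blast
    then show "C \<in> M2_orbits" using \<Psi> represents_M2_bullet by (auto simp: M2_orbits_def)
  next
    fix C :: "('a^2^2) set" assume "C \<in> M2_orbits"
    then obtain \<alpha> where "\<alpha> \<in> M2_bullet" "C = dc2 \<alpha>" by (auto simp: M2_orbits_def)
    then obtain x \<beta> where "represents x \<beta>" "C = dc2 \<beta>" using every_orbit_represented by blast
    then show "C \<in> \<Psi> ` orbit_indices P k" using \<Psi> orbit_indices_iff_represents by blast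
  qed
  \<comment> \<open>A lift \<open>a'\<close> agrees with \<open>u\<close> up to a precision of at
    least \<open>1\<close>, so it is again a unit with the same index, and
    \<open>rep i j l a'\<close> represents that index as well.\<close>
  have lift: "\<Psi> (main_index i j l u) = dc2 (rep i j l a')"
    if r: "(i, j, l, u) \<in> main_range"
      and "a' \<in> residue_class (ideal_epow P (precision i j l u)) u" for i j l u a'
  proof -
    have r': "0 < i" "i < j" "0 < l" "l < j" "enat j < k" "u dvd 1"
      using r by (auto simp: main_range_def)
    note prec = precision_props[OF r'(1-5), of u]
    have le: "precision i j l u \<le> val P (a' - u)"
      using that(2) residue_class_eq_iff(2)[OF prec(2)] by blast
    then have "\<pi> dvd a' - u" using prec(1) nonunit_iff_val order_trans by blast
    then have u': "a' dvd 1" using r'(6) unit_cong by blast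
    then have "(i, j, l, a') \<in> main_range" using r' by (simp add: main_range_def)
    then have "represents (main_index i j l a') (rep i j l a')" unfolding represents_def by blast
    moreover have "main_index i j l u = main_index i j l a'"
      using main_index_eq_iff[OF r' u'] le by blast
    ultimately show ?thesis using \<Psi> by simp
  qed
  show "parametrises_M2 P \<pi> k \<Psi>"
    unfolding parametrises_M2_def
  proof (intro conjI allI impI ballI)
    show "bij_betw \<Psi> (orbit_indices P k) M2_orbits" using inj image by (simp add: bij_betw_def)
  next
    fix i j l a a' assume "generic i j l a \<in> orbit_indices P k \<and> a' \<in> a"
    then obtain u where "i + l \<noteq> j" "(i, j, l, u) \<in> main_range"
      "a = residue_class (ideal_epow P (precision i j l u)) u" "a' \<in> a"
      unfolding generic_in_orbit_indices_iff by blast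
    then show "\<Psi> (generic i j l a) = dc2 (mat22 (\<pi> ^ i) 1 (\<pi> ^ j * a') (\<pi> ^ l))"
      using lift[of i j l u a'] by (simp add: main_index_def rep_def)
  next
    fix i j l \<delta> a a'
    assume "special i j l \<delta> a \<in> orbit_indices P k \<and> a' \<in> a \<and>
      (\<delta> = k - enat j \<longrightarrow> a' - 1 \<in> ideal_epow P (k - enat j))"
    then obtain u where "i + l = j" "(i, j, l, u) \<in> main_range" "\<delta> = defect j u"
      "a = residue_class (ideal_epow P (precision i j l u)) u" "a' \<in> a"
      unfolding special_in_orbit_indices_iff by blast
    then show "\<Psi> (special i j l \<delta> a) = dc2 (mat22 (\<pi> ^ i) 1 (\<pi> ^ j * a') (\<pi> ^ l))"
      using lift[of i j l u a'] by (simp add: main_index_def rep_def)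
  next
    fix d assume d: "d \<in> D_set k"
    have rep: "represents (degenerate d) \<alpha> \<longleftrightarrow> \<alpha> \<in> M2_bullet \<and> val_mat P \<alpha> = d" for \<alpha>
      using d by (auto simp: represents_def main_index_def Let_def split: if_splits)
    have "\<exists>\<alpha>. represents (degenerate d) \<alpha>"
      using d degenerate_in_orbit_indices_iff orbit_indices_iff_represents by blast
    then show "{dc2 \<alpha> |\<alpha>. \<alpha> \<in> M2_bullet \<and> val_mat P \<alpha> = d} = {\<Psi> (degenerate d)}"
      unfolding rep[symmetric] using \<Psi> by auto
  qed
qed

end

theorem corollary4p2:
  fixes P :: "'a::comm_ring_1 set" and \<pi> :: 'a and k :: enat
  assumes "local_pir P"
    and "P = ideal_gen {\<pi>}"
    and "ring_length P = k"
  shows "(\<exists>\<Phi>. parametrises_GL3 P \<Phi>) \<and> (\<exists>\<Psi>. parametrises_M2 P \<pi> k \<Psi>)"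
proof -
  interpret uniformized_local_pir P \<pi> k
    using assms by unfold_locales
  show ?thesis
    using parametrisation_of_GL3_double_cosets parametrisation_of_M2_orbits by blast
qed

end
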